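(* For every $\tau\in\mathbb{H}^2$ set $$t(\tau)=\frac{\eta^4(\tau/2)\,\eta^8(3\tau)}{\eta^8(\tau)\,\eta^4(3\tau/2)} .$$ Then $$\{t,\tau\}+\frac{81t^4-108t^3+102t^2-12t+1}{2t^2(9t-1)^2(t-1)^2}\,(t')^2=0 .$$
   Context: $\mathbb{H}^2=\{\tau\in\mathbb{C}\mid \Im\tau>0\}$; $\eta(\tau)=e^{2\pi i\tau/24}\prod_{n\ge1}(1-e^{2\pi i n\tau})$ is the Dedekind eta function and $\eta^k(r\tau)=(\eta(r\tau))^k$. The prime denotes $d/d\tau$, and the Schwarzian derivative of $y=y(x)$ is $\{y,x\}=\frac{y'''}{y'}-\frac32\left(\frac{y''}{y'}\right)^2$, derivatives being taken with respect to $x$. *)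

theory Defs
  imports "HOL-Complex_Analysis.Complex_Analysis"
begin

definition upper_half_plane :: "complex set" where
  "upper_half_plane = {\<tau>. Im \<tau> > 0}"

(* The product over n >= 1 is indexed from 0, hence the Suc n. *)
definition dedekind_eta :: "complex \<Rightarrow> complex" where
  "dedekind_eta \<tau> =
     exp (2 * of_real pi * \<i> * \<tau> / 24) *
     (\<Prod>n. 1 - exp (2 * of_real pi * \<i> * of_nat (Suc n) * \<tau>))"

(* {y, x} for a complex function y, with complex derivatives taken at the point x.
   As division by 0 yields 0, the value is meaningful only where deriv y x is nonzero. *)
definition schwarzian :: "(complex \<Rightarrow> complex) \<Rightarrow> complex \<Rightarrow> complex" where
  "schwarzian y x =
     (deriv ^^ 3) y x / deriv y x - 3 / 2 * ((deriv ^^ 2) y x / deriv y x)\<^sup>2"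

definition eta_quotient_t :: "complex \<Rightarrow> complex" where
  "eta_quotient_t \<tau> =
     (dedekind_eta (\<tau> / 2) ^ 4 * dedekind_eta (3 * \<tau>) ^ 8) /
     (dedekind_eta \<tau> ^ 8 * dedekind_eta (3 * \<tau> / 2) ^ 4)"

end

theory Submission
  imports Defs
begin

text \<open>
  Put p = exp (i pi \<tau>), q = p^6 and D = p d/dp, so that d/d\<tau> = i pi D.  The function t is a
  Hauptmodul of level 6 in the variable \<tau>/2, and the ring of modular forms it lives in is a
  polynomial ring on two forms of weight one.  These are, up to the additive constants 1/3 and 1/6,
  the Lambert series eis_a = \<Sum> (p^n - p^(5n)) / (1 - p^(6n)) and
  eis_b = \<Sum> (p^(2n) - p^(4n)) / (1 - p^(6n)), the values at x = p and x = p^2 of the logarithmic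
  derivative of the theta function of the Tate curve with period q.  Adjoining one quasimodular
  series eis_c of weight two makes the ring closed under D.

  The only analytic input is an addition formula for \<rho>(x) = \<Sum> x^n / (1 - q^n), summed over all
  integers n with the term 1/2 at n = 0, in the annulus |q| < |x| < 1: for z = x y,
  \<rho>(x) \<rho>(y) - \<rho>(z) (\<rho>(x) + \<rho>(y)) is a sum of three single series and the
  constant -1/4 (bilateral_addition).  It holds because the coefficients of x^n y^m cancel by a partial fraction
  identity unless n = 0, m = 0 or n = m (bil_coeff_convolution).  Since x = p^k with 0 < k < 6 lies
  inside the annulus, the formula and its derivatives in x and in x, y can be evaluated at these
  points; they express the Eisenstein series of level 6 as quadratic polynomials in eis_a, eis_b
  plus multiples of eis_c (sigma_series_polynomials), and give the system of differential
  equations satisfied by eis_a, eis_b, eis_c (lambert_ode).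

  The group \<Gamma>0(6) has four cusps, and for each of them there is an eta quotient of weight one with
  a simple zero at that cusp alone.  These four are linear forms f, g, h, k in 1, eis_a, eis_b
  with h = f - g and k = f - 9 g: a linear form and an eta quotient with the same
  logarithmic derivative and the same leading coefficient coincide (eta_quotients).  Hence
  t = g / f, the values 0, 1 and 1/9 are omitted, and D t = t h k.  With U = D log (D t) the
  Schwarzian of t is (i pi)^2 (D U - U^2 / 2).  As U is a polynomial in eis_a, eis_b, eis_c,
  the theorem becomes a polynomial identity in these three variables (form_identities).
\<close>

section \<open>An addition formula for bilateral Lambert series\<close>

lemma abs_summable_times_product:
  fixes f :: "'a \<Rightarrow> complex" and g :: "'b \<Rightarrow> complex"
  assumes f: "(\<lambda>x. norm (f x)) summable_on A" and g: "(\<lambda>y. norm (g y)) summable_on B"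
  shows "(\<lambda>z. norm (case z of (x, y) \<Rightarrow> f x * g y)) summable_on (A \<times> B)"
proof (subst Infinite_Sum.abs_summable_on_Sigma_iff, intro conjI ballI)
  fix x
  show "(\<lambda>y. norm (case (x, y) of (x, y) \<Rightarrow> f x * g y)) summable_on B"
    using summable_on_cmult_right[OF g, of "norm (f x)"] by (simp add: norm_mult)
next
  have "(\<lambda>x. norm (f x) * (\<Sum>\<^sub>\<infinity>y\<in>B. norm (g y))) summable_on A"
    by (intro summable_on_cmult_left f)
  thus "(\<lambda>x. norm (\<Sum>\<^sub>\<infinity>y\<in>B. norm (case (x, y) of (x, y) \<Rightarrow> f x * g y))) summable_on A"
    by (simp add: norm_mult infsum_cmult_right' infsum_nonneg)
qed

lemma has_sum_times_product:
  fixes f :: "'a \<Rightarrow> complex" and g :: "'b \<Rightarrow> complex"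
  assumes f: "(\<lambda>x. norm (f x)) summable_on A" and g: "(\<lambda>y. norm (g y)) summable_on B"
  shows "((\<lambda>(x, y). f x * g y) has_sum (infsum f A * infsum g B)) (A \<times> B)"
proof -
  have "(\<lambda>(x, y). f x * g y) summable_on (A \<times> B)"
    by (rule abs_summable_summable[OF abs_summable_times_product[OF f g]])
  moreover have "((\<lambda>y. f x * g y) has_sum (f x * infsum g B)) B" for x
    by (intro has_sum_cmult_right has_sum_infsum abs_summable_summable[OF g])
  moreover have "((\<lambda>x. f x * infsum g B) has_sum (infsum f A * infsum g B)) A"
    by (intro has_sum_cmult_left has_sum_infsum abs_summable_summable[OF f])
  ultimately show ?thesis
    by (intro has_sum_SigmaI) auto
qed

text \<open>Pairing the indices n and -n is how the bilateral series turn into ordinary Lambert series.\<close>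
lemma has_sum_int_nat:
  fixes F :: "int \<Rightarrow> complex"
  assumes "F summable_on UNIV"
  shows "((\<lambda>n::nat. F (int (Suc n)) + F (- int (Suc n))) has_sum (infsum F UNIV - F 0)) UNIV"
proof -
  define P where "P = (\<lambda>n::nat. int (Suc n))"
  define N where "N = (\<lambda>n::nat. - int (Suc n))"
  have rP: "range P = {1..}"
  proof (intro equalityI subsetI)
    fix n :: int assume "n \<in> {1..}"
    then have "n = P (nat (n - 1))" by (auto simp: P_def)
    thus "n \<in> range P" by blast
  qed (auto simp: P_def)
  have rN: "range N = {..-1}"
  proof (intro equalityI subsetI)
    fix n :: int assume "n \<in> {..-1}"
    then have "n = N (nat (- n - 1))" by (auto simp: N_def)
    thus "n \<in> range N" by blast
  qed (auto simp: N_def)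
  have inj: "inj P" "inj N" by (auto simp: P_def N_def inj_on_def)
  have sP: "(F has_sum infsum F (range P)) (range P)" and sN: "(F has_sum infsum F (range N)) (range N)"
    by (intro has_sum_infsum summable_on_subset_banach[OF assms] subset_UNIV)+
  have "(F has_sum (infsum F (range P) + infsum F (range N))) (range P \<union> range N)"
    by (rule has_sum_Un_disjoint[OF sP sN]) (auto simp: rP rN)
  moreover have "(F has_sum F 0) {0}"
    by (rule has_sum_finiteI) auto
  ultimately have "(F has_sum (infsum F (range P) + infsum F (range N) + F 0)) (range P \<union> range N \<union> {0})"
    by (rule has_sum_Un_disjoint) (auto simp: rP rN)
  also have "range P \<union> range N \<union> {0} = UNIV"
    unfolding rP rN by auto
  finally have *: "infsum F UNIV = infsum F (range P) + infsum F (range N) + F 0"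
    by (rule infsumI)
  have "((\<lambda>n. F (P n)) has_sum infsum F (range P)) UNIV" "((\<lambda>n. F (N n)) has_sum infsum F (range N)) UNIV"
    using sP sN inj by (auto simp: has_sum_reindex o_def)
  from has_sum_add[OF this] show ?thesis
    unfolding * by (simp add: P_def N_def)
qed

lemma summable_power_times_geometric:
  assumes "0 \<le> R" "R < (1::real)"
  shows "summable (\<lambda>n. real n ^ j * R ^ n)"
  using assms
proof (induction j arbitrary: R)
  case 0
  thus ?case by (simp add: summable_geometric)
next
  case (Suc j)
  have "summable (\<lambda>n. diffs (\<lambda>n. real n ^ j) n * R ^ n)"
  proof (rule termdiff_converges[where K = 1])
    show "norm R < 1" using Suc.prems by simp
    fix x :: real assume x: "norm x < 1"
    have "summable (\<lambda>n. norm (real n ^ j * x ^ n))"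
      using Suc.IH[of "\<bar>x\<bar>"] x by (simp add: abs_mult power_abs)
    thus "summable (\<lambda>n. real n ^ j * x ^ n)"
      by (rule summable_norm_cancel)
  qed
  hence S: "summable (\<lambda>n. (1 + real n) ^ Suc j * R ^ n)"
    by (simp add: diffs_def mult_ac add_ac)
  have "real n ^ Suc j * R ^ n \<le> (1 + real n) ^ Suc j * R ^ n" for n
    using Suc.prems by (intro mult_right_mono power_mono) auto
  thus ?case
    using Suc.prems by (intro summable_comparison_test'[OF S, of 0]) auto
qed

lemma summable_on_int_geometric_bound:
  fixes F :: "int \<Rightarrow> complex"
  assumes R: "0 \<le> R" "R < 1"
  assumes bound: "\<And>n. norm (F n) \<le> C * (real_of_int \<bar>n\<bar> ^ j * R ^ nat \<bar>n\<bar>)"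
  shows "(\<lambda>n. norm (F n)) summable_on UNIV"
proof -
  define G where "G = (\<lambda>n::int. real_of_int \<bar>n\<bar> ^ j * R ^ nat \<bar>n\<bar>)"
  have nat: "(\<lambda>n::nat. real n ^ j * R ^ n) summable_on UNIV"
    using summable_power_times_geometric[OF R, of j] R
    by (subst summable_on_UNIV_nonneg_real_iff) auto
  have 1: "G summable_on range int"
    using nat by (subst summable_on_reindex) (auto simp: G_def o_def)
  have 2: "G summable_on range (\<lambda>n. - int n)"
    using nat by (subst summable_on_reindex) (auto simp: G_def o_def inj_on_def)
  have "G summable_on (range int \<union> range (\<lambda>n. - int n))"
    by (rule summable_on_union[OF 1 2])
  also have "range int \<union> range (\<lambda>n. - int n) = UNIV"
  proof -
    have "n \<in> range int \<union> range (\<lambda>n. - int n)" for n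
      by (cases n rule: int_cases2) auto
    thus ?thesis by blast
  qed
  finally have "(\<lambda>n. C * G n) summable_on UNIV"
    by (rule summable_on_cmult_right)
  thus ?thesis
    by (rule summable_on_comparison_test) (use bound in \<open>auto simp: G_def\<close>)
qed

text \<open>The value 1/2 at 0 is the mean of the limits 0 and 1 of 1 / (1 - q^n) for
  n \<rightarrow> -\<infinity> and n \<rightarrow> \<infinity>; with it the reflection rule
  bil_coeff_minus has no exception.\<close>
definition bil_coeff :: "complex \<Rightarrow> int \<Rightarrow> complex" where
  "bil_coeff q n = (if n = 0 then 1 / 2 else 1 / (1 - q powi n))"

definition sq_coeff :: "complex \<Rightarrow> int \<Rightarrow> complex" where
  "sq_coeff q n = (if n = 0 then 0 else q powi n / (1 - q powi n)\<^sup>2)"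

text \<open>The exponent j counts applications of x d/dx.  For j = 0 the function is, up to sign, the
  logarithmic derivative in log x of the theta function with period q.\<close>
definition bilateral :: "complex \<Rightarrow> nat \<Rightarrow> complex \<Rightarrow> complex" where
  "bilateral q j x = (\<Sum>\<^sub>\<infinity>n. of_int n ^ j * bil_coeff q n * x powi n)"

definition bilateral_sq :: "complex \<Rightarrow> nat \<Rightarrow> complex \<Rightarrow> complex" where
  "bilateral_sq q j x = (\<Sum>\<^sub>\<infinity>n. of_int n ^ j * sq_coeff q n * x powi n)"

lemma powi_neq_1:
  fixes q :: complex
  assumes "q \<noteq> 0" "norm q < 1" "n \<noteq> (0::int)"
  shows "q powi n \<noteq> 1"
proof -
  have *: "q ^ m \<noteq> 1" if "m > 0" for m
  proof
    assume "q ^ m = 1"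
    hence "norm q ^ m = 1" by (metis norm_one norm_power)
    moreover have "norm q ^ m < 1"
      using assms that by (intro power_less_one_iff[THEN iffD2]) auto
    ultimately show False by simp
  qed
  show ?thesis
  proof (cases "n > 0")
    case True
    thus ?thesis using *[of "nat n"] by (simp add: power_int_def)
  next
    case False
    thus ?thesis using *[of "nat (-n)"] assms by (simp add: power_int_def power_inverse)
  qed
qed

lemma bil_coeff_minus:
  assumes "q \<noteq> 0" "norm q < 1"
  shows "bil_coeff q (- n) = 1 - bil_coeff q n"
proof (cases "n = 0")
  case False
  have "1 / (1 - inverse A) = 1 - 1 / (1 - A)" if "A \<noteq> 0" "A \<noteq> 1" for A :: complex
    using that by (simp add: field_simps)
  thus ?thesis
    using False powi_neq_1[OF assms False] assms by (simp add: bil_coeff_def power_int_minus)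
qed (simp add: bil_coeff_def)

lemma sq_coeff_eq:
  assumes "q \<noteq> 0" "norm q < 1" "n \<noteq> 0"
  shows "sq_coeff q n = bil_coeff q n * (bil_coeff q n - 1)"
proof -
  define u where "u = 1 - q powi n"
  have "u \<noteq> 0" using powi_neq_1[OF assms] by (simp add: u_def)
  hence "1 / u * (1 / u - 1) = (1 - u) / u\<^sup>2"
    by (simp add: field_simps power2_eq_square)
  thus ?thesis using assms by (simp add: sq_coeff_def bil_coeff_def u_def)
qed

lemma norm_bil_coeff_le:
  assumes q: "q \<noteq> 0" "norm q < 1" and "n > 0"
  shows "norm (bil_coeff q n) \<le> 1 / (1 - norm q)"
proof -
  obtain m where m: "n = int m" "m > 0"
    using assms zero_less_imp_eq_int by blast
  have "norm q ^ m \<le> norm q ^ 1"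
    using q m by (intro power_decreasing) auto
  hence "1 - norm q \<le> 1 - norm (q ^ m)" by (simp add: norm_power)
  also have "\<dots> \<le> norm (1 - q ^ m)"
    by (metis norm_one norm_triangle_ineq2)
  finally show ?thesis using q m
    by (simp add: bil_coeff_def norm_divide frac_le)
qed

text \<open>For n, m and n - m nonzero this is the partial fraction identity
  1/((1-A)(1-B)) = 1/((1-B)(1-A/B)) + 1/((1-A)(1-B/A)) with A = q^n, B = q^m.  On the three
  exceptional lines the sum of the three products degenerates to \<rho> (\<rho> - 1), which is the
  coefficient q^n / (1 - q^n)^2.\<close>
lemma bil_coeff_convolution:
  fixes q :: complex
  assumes q: "q \<noteq> 0" "norm q < 1"
  shows "bil_coeff q n * bil_coeff q m - bil_coeff q m * bil_coeff q (n - m)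
            - bil_coeff q n * bil_coeff q (m - n) =
         (if n = 0 \<and> m = 0 then - (1 / 4) else 0) + (if m = 0 then sq_coeff q n else 0)
            + (if n = 0 then sq_coeff q m else 0) + (if n = m then sq_coeff q n else 0)"
proof -
  note [simp] = bil_coeff_minus[OF q]
  consider "n = 0" | "n \<noteq> 0" "m = 0" | "n \<noteq> 0" "m = n" | "n \<noteq> 0" "m \<noteq> 0" "m \<noteq> n" by blast
  thus ?thesis
  proof cases
    case 1
    thus ?thesis using sq_coeff_eq[OF q, of m]
      by (cases "m = 0") (auto simp: bil_coeff_def[of _ 0] sq_coeff_def[of _ 0] algebra_simps)
  next
    case 2
    thus ?thesis using sq_coeff_eq[OF q, of n]
      by (auto simp: bil_coeff_def[of _ 0] algebra_simps)
  next
    case 3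
    thus ?thesis using sq_coeff_eq[OF q, of n]
      by (auto simp: bil_coeff_def[of _ 0] algebra_simps)
  next
    case 4
    define A B where "A = q powi n" and "B = q powi m"
    have AB: "A \<noteq> 0" "B \<noteq> 0" "A \<noteq> 1" "B \<noteq> 1"
      using 4 q powi_neq_1[OF q] by (auto simp: A_def B_def)
    have d: "q powi (n - m) = A / B" "q powi (m - n) = B / A"
      using q by (simp_all add: A_def B_def power_int_diff)
    have "A / B \<noteq> 1" unfolding d(1)[symmetric] using 4 by (intro powi_neq_1 q) auto
    hence "A \<noteq> B" using AB by auto
    have "bil_coeff q n * bil_coeff q m - bil_coeff q m * bil_coeff q (n - m)
            - bil_coeff q n * bil_coeff q (m - n)
         = 1 / ((1 - A) * (1 - B)) - 1 / ((1 - B) * (1 - A / B)) - 1 / ((1 - A) * (1 - B / A))"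
      using 4 by (simp add: bil_coeff_def d flip: A_def B_def)
    also have "\<dots> = 0"
    proof -
      define d where "d = B - A"
      have r: "1 - A / B = d / B" "1 - B / A = - d / A"
        using AB by (auto simp: field_simps d_def)
      have nz: "1 - A \<noteq> 0" "1 - B \<noteq> 0" "d \<noteq> 0"
        using AB \<open>A \<noteq> B\<close> by (auto simp: d_def)
      have "1 / (a * b) - 1 / (b * (d / B)) - 1 / (a * (- d / A)) = (d - B * a + A * b) / (a * b * d)"
        if "a \<noteq> 0" "b \<noteq> 0" for a b :: complex
        using that nz AB by (simp add: field_simps)
      from this[OF nz(1,2)] show ?thesis
        unfolding r by (simp add: d_def algebra_simps)
    qed
    finally show ?thesis using 4 by simp
  qed
qed

text \<open>The terms decay like |x|^n for n \<rightarrow> \<infinity> and like |q/x|^(-n) for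
  n \<rightarrow> -\<infinity>, whence the annulus.\<close>
lemma bilateral_summable:
  assumes q: "q \<noteq> 0" "norm q < 1" and x: "norm q < norm x" "norm x < 1"
  shows "(\<lambda>n. norm (of_int n ^ j * bil_coeff q n * x powi n)) summable_on UNIV"
proof (rule summable_on_int_geometric_bound)
  define R where "R = max (norm x) (norm q / norm x)"
  define C where "C = 1 / (1 - norm q)"
  have x0: "norm x > 0" using x q by (metis norm_ge_zero order_le_less_trans)
  show "0 \<le> R" "R < 1"
    using x x0 by (auto simp: R_def le_max_iff_disj)
  have C1: "C \<ge> 1" using q by (simp add: C_def)
  fix n :: int
  have main: "norm (bil_coeff q n * x powi n) \<le> C * R ^ nat \<bar>n\<bar>"
  proof (cases n "0 :: int" rule: linorder_cases)
    case equal
    thus ?thesis using C1 by (simp add: bil_coeff_def)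
  next
    case greater
    then obtain m where m: "n = int m" "m > 0"
      using zero_less_imp_eq_int by blast
    have "norm (bil_coeff q n * x powi n) = norm (bil_coeff q n) * norm x ^ m"
      using m by (simp add: norm_mult norm_power)
    also have "\<dots> \<le> C * R ^ m"
      using norm_bil_coeff_le[OF q greater] C1 q
      by (intro mult_mono power_mono) (auto simp: R_def C_def)
    finally show ?thesis using m by simp
  next
    case less
    then obtain m where m: "n = - int m" "m > 0"
      by (metis minus_equation_iff neg_0_less_iff_less zero_less_imp_eq_int)
    have q1: "q ^ m \<noteq> 1"
      using powi_neq_1[OF q, of "int m"] m by simp
    have "1 - 1 / (1 - Q) = - Q * (1 / (1 - Q))" if "Q \<noteq> 1" for Q :: complex
      using that by (simp add: field_simps)
    from this[OF q1] have "bil_coeff q n = - (q ^ m) * bil_coeff q (int m)"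
      using m q by (simp add: bil_coeff_minus) (simp add: bil_coeff_def)
    hence "bil_coeff q n * x powi n = - (bil_coeff q (int m) * (q / x) ^ m)"
      using m by (simp add: power_int_minus divide_inverse power_mult_distrib power_inverse)
    hence "norm (bil_coeff q n * x powi n) = norm (bil_coeff q (int m)) * (norm q / norm x) ^ m"
      by (simp add: norm_mult norm_power norm_divide)
    also have "\<dots> \<le> C * R ^ m"
      using norm_bil_coeff_le[OF q, of "int m"] C1 m q
      by (intro mult_mono power_mono) (auto simp: R_def C_def)
    finally show ?thesis using m by simp
  qed
  have "norm (of_int n ^ j * bil_coeff q n * x powi n) = real_of_int \<bar>n\<bar> ^ j * norm (bil_coeff q n * x powi n)"
    by (simp add: norm_mult norm_power)
  also have "\<dots> \<le> real_of_int \<bar>n\<bar> ^ j * (C * R ^ nat \<bar>n\<bar>)"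
    by (intro mult_left_mono main) auto
  finally show "norm (of_int n ^ j * bil_coeff q n * x powi n) \<le> C * (real_of_int \<bar>n\<bar> ^ j * R ^ nat \<bar>n\<bar>)"
    by (simp add: mult_ac)
qed

lemma bilateral_sq_summable:
  assumes q: "q \<noteq> 0" "norm q < 1" and x: "norm q < norm x" "norm x < 1"
  shows "(\<lambda>n. norm (of_int n ^ j * sq_coeff q n * x powi n)) summable_on UNIV"
proof -
  define C where "C = 1 / (1 - norm q)"
  have C0: "C \<ge> 1" using q by (simp add: C_def)
  have bd: "norm (bil_coeff q n) \<le> C + 1" if "n \<noteq> 0" for n
  proof (cases "n > 0")
    case True
    thus ?thesis using norm_bil_coeff_le[OF q True] by (simp add: C_def)
  next
    case False
    hence "norm (bil_coeff q (- n)) \<le> C"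
      using norm_bil_coeff_le[OF q, of "- n"] that by (simp add: C_def)
    moreover have "bil_coeff q n = 1 - bil_coeff q (- n)"
      using bil_coeff_minus[OF q, of "- n"] by simp
    ultimately show ?thesis
      using norm_triangle_ineq4[of 1 "bil_coeff q (- n)"] by simp
  qed
  have "norm (sq_coeff q n) \<le> (C + 2) * norm (bil_coeff q n)" for n
  proof (cases "n = 0")
    case False
    have "norm (bil_coeff q n - 1) \<le> C + 2"
      using norm_triangle_ineq4[of "bil_coeff q n" 1] bd[OF False] by simp
    hence "norm (bil_coeff q n - 1) * norm (bil_coeff q n) \<le> (C + 2) * norm (bil_coeff q n)"
      by (rule mult_right_mono) auto
    thus ?thesis
      using sq_coeff_eq[OF q False] by (simp add: norm_mult mult_ac)
  qed (use C0 in \<open>auto simp: sq_coeff_def\<close>)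
  hence *: "norm (of_int n ^ j * sq_coeff q n * x powi n)
      \<le> norm ((of_real (C + 2) :: complex) * (of_int n ^ j * bil_coeff q n * x powi n))" for n
    using C0 mult_left_mono[of "norm (sq_coeff q n)" "(C + 2) * norm (bil_coeff q n)" "norm (of_int n ^ j :: complex) * norm (x powi n)"]
    by (simp add: norm_mult mult_ac del: of_real_add)
  have "(\<lambda>n. norm ((of_real (C + 2) :: complex) * (of_int n ^ j * bil_coeff q n * x powi n))) summable_on UNIV"
    unfolding norm_mult[of "of_real (C + 2)"]
    by (intro summable_on_cmult_right bilateral_summable assms)
  thus ?thesis
    by (rule Infinite_Sum.abs_summable_on_comparison_test) (rule *)
qed

lemma has_sum_bilateral_mult:
  assumes q: "q \<noteq> 0" "norm q < 1" and x: "norm q < norm x" "norm x < 1"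
    and y: "norm q < norm y" "norm y < 1"
  shows "((\<lambda>(n, m). (of_int n ^ i * bil_coeff q n * x powi n) * (of_int m ^ j * bil_coeff q m * y powi m))
            has_sum (bilateral q i x * bilateral q j y)) UNIV"
  using has_sum_times_product[OF bilateral_summable[OF q x, of i] bilateral_summable[OF q y, of j]]
  by (simp add: bilateral_def)

lemma has_sum_bilateral_sq:
  assumes q: "q \<noteq> 0" "norm q < 1" and x: "norm q < norm x" "norm x < 1"
  shows "((\<lambda>n. of_int n ^ j * sq_coeff q n * x powi n) has_sum bilateral_sq q j x) UNIV"
  unfolding bilateral_sq_def using abs_summable_summable[OF bilateral_sq_summable[OF assms, of j]]
  by (rule has_sum_infsum)

lemma has_sum_diff:
  fixes f g :: "'a \<Rightarrow> complex"
  assumes "(f has_sum a) A" "(g has_sum b) A"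
  shows "((\<lambda>x. f x - g x) has_sum (a - b)) A"
  using has_sum_add[OF assms(1) has_sum_cmult_right[OF assms(2), of "- 1"]] by simp

lemma has_sum_on_line:
  assumes F: "((\<lambda>n. f (l n)) has_sum S) UNIV" and inj: "inj l"
    and out: "\<And>z. z \<notin> range l \<Longrightarrow> f z = 0"
  shows "(f has_sum S) UNIV"
proof -
  have "(f has_sum S) (range l)"
    using F inj by (subst has_sum_reindex) (auto simp: o_def)
  also have "?this \<longleftrightarrow> ?thesis"
    by (intro has_sum_cong_neutral) (auto simp: out)
  finally show ?thesis .
qed

lemma has_sum_three_lines:
  fixes F G H :: "int \<Rightarrow> complex"
  assumes "(F has_sum a) UNIV" "(G has_sum b) UNIV" "(H has_sum c) UNIV"
  shows "((\<lambda>(n, m). (if m = 0 then F n else 0) + (if n = 0 then G m else 0) + (if n = m then H n else 0))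
            has_sum (a + b + c)) UNIV"
proof -
  have "((\<lambda>(n, m). if m = 0 then F n else 0) has_sum a) UNIV"
    by (rule has_sum_on_line[where l = "\<lambda>n. (n, 0)"]) (use assms in \<open>auto simp: inj_on_def image_iff\<close>)
  moreover have "((\<lambda>(n, m). if n = 0 then G m else 0) has_sum b) UNIV"
    by (rule has_sum_on_line[where l = "\<lambda>m. (0, m)"]) (use assms in \<open>auto simp: inj_on_def image_iff\<close>)
  moreover have "((\<lambda>(n, m). if n = m then H n else 0) has_sum c) UNIV"
    by (rule has_sum_on_line[where l = "\<lambda>n. (n, n)"]) (use assms in \<open>auto simp: inj_on_def image_iff\<close>)
  ultimately have "((\<lambda>z. (case z of (n, m) \<Rightarrow> if m = 0 then F n else 0)
        + (case z of (n, m) \<Rightarrow> if n = 0 then G m else 0)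
        + (case z of (n, m) \<Rightarrow> if n = m then H n else 0)) has_sum (a + b + c)) UNIV"
    by (intro has_sum_add)
  thus ?thesis by (simp add: case_prod_unfold)
qed

text \<open>The substitutions that move x^k z^m and z^n y^k, with z = x y, to the monomial x^n y^m.\<close>
lemma has_sum_shear:
  fixes f :: "int \<times> int \<Rightarrow> complex"
  assumes "(f has_sum S) UNIV"
  shows "((\<lambda>(n, m). f (n - m, m)) has_sum S) UNIV" "((\<lambda>(n, m). f (n, m - n)) has_sum S) UNIV"
proof -
  show "((\<lambda>(n, m). f (n - m, m)) has_sum S) UNIV"
    using assms
    by (subst has_sum_reindex_bij_witness[where j = "\<lambda>(n, m). (n - m, m)" and i = "\<lambda>(k, m). (k + m, m)" and h = f and T = UNIV])
       auto
  show "((\<lambda>(n, m). f (n, m - n)) has_sum S) UNIV"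
    using assms
    by (subst has_sum_reindex_bij_witness[where j = "\<lambda>(n, m). (n, m - n)" and i = "\<lambda>(n, k). (n, k + n)" and h = f and T = UNIV])
       auto
qed

locale annulus_pair =
  fixes q x y z :: complex
  assumes q: "q \<noteq> 0" "norm q < 1" and x: "norm q < norm x" "norm x < 1"
    and y: "norm q < norm y" "norm y < 1" and z_eq: "z = x * y" and z: "norm q < norm z"
begin

lemma z_less: "norm z < 1"
  using x(2) y(2) unfolding z_eq norm_mult
  by (metis mult_strict_mono' mult_1 norm_ge_zero)

lemma nonzero: "x \<noteq> 0" "y \<noteq> 0"
  using x y by (metis norm_ge_zero norm_zero not_less)+

lemma has_sum_products:
  shows "((\<lambda>(n, m). of_int n ^ i * of_int m ^ j * (bil_coeff q n * bil_coeff q m * (x powi n * y powi m)))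
           has_sum (bilateral q i x * bilateral q j y)) UNIV"
    and "((\<lambda>(n, m). of_int (n - m) ^ i * of_int m ^ j * (bil_coeff q m * bil_coeff q (n - m) * (x powi n * y powi m)))
           has_sum (bilateral q i x * bilateral q j z)) UNIV"
    and "((\<lambda>(n, m). of_int n ^ i * of_int (m - n) ^ j * (bil_coeff q n * bil_coeff q (m - n) * (x powi n * y powi m)))
           has_sum (bilateral q i z * bilateral q j y)) UNIV"
proof -
  note zz = z z_less
  have pw: "x powi (n - m) * z powi m = x powi n * y powi m" "z powi n * y powi (m - n) = x powi n * y powi m" for n m
    using nonzero by (simp_all add: z_eq power_int_diff power_int_mult_distrib)
  show "((\<lambda>(n, m). of_int n ^ i * of_int m ^ j * (bil_coeff q n * bil_coeff q m * (x powi n * y powi m)))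
           has_sum (bilateral q i x * bilateral q j y)) UNIV"
    using has_sum_bilateral_mult[OF q x y, of i j] by (simp add: mult_ac)
  have "((\<lambda>(n, m). of_int (n - m) ^ i * of_int m ^ j * (bil_coeff q m * bil_coeff q (n - m) * (x powi (n - m) * z powi m)))
           has_sum (bilateral q i x * bilateral q j z)) UNIV"
    using has_sum_shear(1)[OF has_sum_bilateral_mult[OF q x zz, of i j]] by (simp add: mult_ac)
  thus "((\<lambda>(n, m). of_int (n - m) ^ i * of_int m ^ j * (bil_coeff q m * bil_coeff q (n - m) * (x powi n * y powi m)))
           has_sum (bilateral q i x * bilateral q j z)) UNIV"
    unfolding pw .
  have "((\<lambda>(n, m). of_int n ^ i * of_int (m - n) ^ j * (bil_coeff q n * bil_coeff q (m - n) * (z powi n * y powi (m - n))))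
           has_sum (bilateral q i z * bilateral q j y)) UNIV"
    using has_sum_shear(2)[OF has_sum_bilateral_mult[OF q zz y, of i j]] by (simp add: mult_ac)
  thus "((\<lambda>(n, m). of_int n ^ i * of_int (m - n) ^ j * (bil_coeff q n * bil_coeff q (m - n) * (x powi n * y powi m)))
           has_sum (bilateral q i z * bilateral q j y)) UNIV"
    unfolding pw .
qed

lemma z_powi: "z powi n = x powi n * y powi n"
  by (simp add: z_eq power_int_mult_distrib)

text \<open>Compare coefficients of x^n y^m.  The three exceptional lines m = 0, n = 0 and n = m contribute
  the series at x, y and z = x y, and their common point the constant -1/4.\<close>
lemma bilateral_addition:
  "bilateral q 0 x * bilateral q 0 y - bilateral q 0 x * bilateral q 0 z - bilateral q 0 z * bilateral q 0 y =
     bilateral_sq q 0 x + bilateral_sq q 0 y + bilateral_sq q 0 z - 1 / 4"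
proof -
  let ?K = "\<lambda>n m. bil_coeff q n * bil_coeff q m - bil_coeff q m * bil_coeff q (n - m)
            - bil_coeff q n * bil_coeff q (m - n)"
  have "((\<lambda>w. (case w of (n, m) \<Rightarrow> of_int n ^ 0 * of_int m ^ 0 * (bil_coeff q n * bil_coeff q m * (x powi n * y powi m)))
      - (case w of (n, m) \<Rightarrow> of_int (n - m) ^ 0 * of_int m ^ 0 * (bil_coeff q m * bil_coeff q (n - m) * (x powi n * y powi m)))
      - (case w of (n, m) \<Rightarrow> of_int n ^ 0 * of_int (m - n) ^ 0 * (bil_coeff q n * bil_coeff q (m - n) * (x powi n * y powi m))))
     has_sum (bilateral q 0 x * bilateral q 0 y - bilateral q 0 x * bilateral q 0 z - bilateral q 0 z * bilateral q 0 y)) UNIV"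
    by (intro has_sum_diff has_sum_products)
  also have "(\<lambda>w. (case w of (n, m) \<Rightarrow> of_int n ^ 0 * of_int m ^ 0 * (bil_coeff q n * bil_coeff q m * (x powi n * y powi m)))
      - (case w of (n, m) \<Rightarrow> of_int (n - m) ^ 0 * of_int m ^ 0 * (bil_coeff q m * bil_coeff q (n - m) * (x powi n * y powi m)))
      - (case w of (n, m) \<Rightarrow> of_int n ^ 0 * of_int (m - n) ^ 0 * (bil_coeff q n * bil_coeff q (m - n) * (x powi n * y powi m))))
     = (\<lambda>(n, m). ?K n m * (x powi n * y powi m))"
    by (auto simp: fun_eq_iff algebra_simps)
  finally have 1: "((\<lambda>(n, m). ?K n m * (x powi n * y powi m)) has_sum
      (bilateral q 0 x * bilateral q 0 y - bilateral q 0 x * bilateral q 0 z - bilateral q 0 z * bilateral q 0 y)) UNIV" .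
  have "((\<lambda>w. (case w of (n, m) \<Rightarrow> (if m = 0 then of_int n ^ 0 * sq_coeff q n * x powi n else 0)
      + (if n = 0 then of_int m ^ 0 * sq_coeff q m * y powi m else 0)
      + (if n = m then of_int n ^ 0 * sq_coeff q n * z powi n else 0)) +
       (if w = (0, 0) then - (1 / 4) else 0))
     has_sum (bilateral_sq q 0 x + bilateral_sq q 0 y + bilateral_sq q 0 z + - (1 / 4))) UNIV"
    by (intro has_sum_add has_sum_three_lines has_sum_bilateral_sq q x y z z_less
          has_sum_finite_neutralI[of "{(0, 0)}"]) auto
  also have "(\<lambda>w. (case w of (n, m) \<Rightarrow> (if m = 0 then of_int n ^ 0 * sq_coeff q n * x powi n else 0)
      + (if n = 0 then of_int m ^ 0 * sq_coeff q m * y powi m else 0)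
      + (if n = m then of_int n ^ 0 * sq_coeff q n * z powi n else 0)) +
       (if w = (0, 0) then - (1 / 4) else 0)) = (\<lambda>(n, m). ?K n m * (x powi n * y powi m))"
    unfolding bil_coeff_convolution[OF q] by (auto simp: fun_eq_iff z_powi)
  finally show ?thesis using 1 by (simp add: has_sum_unique)
qed

text \<open>The derivative x d/dx of the addition formula, obtained by weighting the coefficient of x^n y^m
  with n instead of differentiating series.\<close>
lemma bilateral_addition_deriv:
  "bilateral q 1 x * bilateral q 0 y - (bilateral q 0 x * bilateral q 1 z + bilateral q 1 x * bilateral q 0 z) - bilateral q 1 z * bilateral q 0 y =
     bilateral_sq q 1 x + bilateral_sq q 1 z"
proof -
  let ?K = "\<lambda>n m. bil_coeff q n * bil_coeff q m - bil_coeff q m * bil_coeff q (n - m)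
            - bil_coeff q n * bil_coeff q (m - n)"
  have "((\<lambda>w. (case w of (n, m) \<Rightarrow> of_int n ^ 1 * of_int m ^ 0 * (bil_coeff q n * bil_coeff q m * (x powi n * y powi m)))
      - ((case w of (n, m) \<Rightarrow> of_int (n - m) ^ 0 * of_int m ^ 1 * (bil_coeff q m * bil_coeff q (n - m) * (x powi n * y powi m)))
       + (case w of (n, m) \<Rightarrow> of_int (n - m) ^ 1 * of_int m ^ 0 * (bil_coeff q m * bil_coeff q (n - m) * (x powi n * y powi m))))
      - (case w of (n, m) \<Rightarrow> of_int n ^ 1 * of_int (m - n) ^ 0 * (bil_coeff q n * bil_coeff q (m - n) * (x powi n * y powi m))))
     has_sum (bilateral q 1 x * bilateral q 0 y - (bilateral q 0 x * bilateral q 1 z + bilateral q 1 x * bilateral q 0 z) - bilateral q 1 z * bilateral q 0 y)) UNIV"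
    by (intro has_sum_diff has_sum_add has_sum_products)
  also have "(\<lambda>w. (case w of (n, m) \<Rightarrow> of_int n ^ 1 * of_int m ^ 0 * (bil_coeff q n * bil_coeff q m * (x powi n * y powi m)))
      - ((case w of (n, m) \<Rightarrow> of_int (n - m) ^ 0 * of_int m ^ 1 * (bil_coeff q m * bil_coeff q (n - m) * (x powi n * y powi m)))
       + (case w of (n, m) \<Rightarrow> of_int (n - m) ^ 1 * of_int m ^ 0 * (bil_coeff q m * bil_coeff q (n - m) * (x powi n * y powi m))))
      - (case w of (n, m) \<Rightarrow> of_int n ^ 1 * of_int (m - n) ^ 0 * (bil_coeff q n * bil_coeff q (m - n) * (x powi n * y powi m))))
     = (\<lambda>(n, m). ?K n m * (of_int n * (x powi n * y powi m)))"
    by (auto simp: fun_eq_iff algebra_simps)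
  finally have 1: "((\<lambda>(n, m). ?K n m * (of_int n * (x powi n * y powi m))) has_sum
      (bilateral q 1 x * bilateral q 0 y - (bilateral q 0 x * bilateral q 1 z + bilateral q 1 x * bilateral q 0 z) - bilateral q 1 z * bilateral q 0 y)) UNIV" .
  have "((\<lambda>(n, m). (if m = 0 then of_int n ^ 1 * sq_coeff q n * x powi n else 0)
      + (if n = 0 then 0 else 0)
      + (if n = m then of_int n ^ 1 * sq_coeff q n * z powi n else 0))
     has_sum (bilateral_sq q 1 x + 0 + bilateral_sq q 1 z)) UNIV"
    by (intro has_sum_three_lines has_sum_bilateral_sq has_sum_0 q x z z_less) auto
  also have "(\<lambda>(n, m). (if m = 0 then of_int n ^ 1 * sq_coeff q n * x powi n else 0)
      + (if n = 0 then 0 else 0)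
      + (if n = m then of_int n ^ 1 * sq_coeff q n * z powi n else 0))
      = (\<lambda>(n, m). ?K n m * (of_int n * (x powi n * y powi m)))"
    unfolding bil_coeff_convolution[OF q] by (auto simp: fun_eq_iff z_powi)
  finally show ?thesis using 1 by (simp add: has_sum_unique)
qed

text \<open>The mixed derivative in x and y: the weight n m leaves only the line n = m.\<close>
lemma bilateral_addition_deriv2:
  "bilateral q 1 x * bilateral q 1 y - (bilateral q 1 x * bilateral q 1 z + bilateral q 0 x * bilateral q 2 z) - (bilateral q 2 z * bilateral q 0 y + bilateral q 1 z * bilateral q 1 y) =
     bilateral_sq q 2 z"
proof -
  let ?K = "\<lambda>n m. bil_coeff q n * bil_coeff q m - bil_coeff q m * bil_coeff q (n - m)
            - bil_coeff q n * bil_coeff q (m - n)"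
  have "((\<lambda>w. (case w of (n, m) \<Rightarrow> of_int n ^ 1 * of_int m ^ 1 * (bil_coeff q n * bil_coeff q m * (x powi n * y powi m)))
      - ((case w of (n, m) \<Rightarrow> of_int (n - m) ^ 1 * of_int m ^ 1 * (bil_coeff q m * bil_coeff q (n - m) * (x powi n * y powi m)))
       + (case w of (n, m) \<Rightarrow> of_int (n - m) ^ 0 * of_int m ^ 2 * (bil_coeff q m * bil_coeff q (n - m) * (x powi n * y powi m))))
      - ((case w of (n, m) \<Rightarrow> of_int n ^ 2 * of_int (m - n) ^ 0 * (bil_coeff q n * bil_coeff q (m - n) * (x powi n * y powi m)))
       + (case w of (n, m) \<Rightarrow> of_int n ^ 1 * of_int (m - n) ^ 1 * (bil_coeff q n * bil_coeff q (m - n) * (x powi n * y powi m)))))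
     has_sum (bilateral q 1 x * bilateral q 1 y - (bilateral q 1 x * bilateral q 1 z + bilateral q 0 x * bilateral q 2 z) - (bilateral q 2 z * bilateral q 0 y + bilateral q 1 z * bilateral q 1 y))) UNIV"
    by (intro has_sum_diff has_sum_add has_sum_products)
  also have "(\<lambda>w. (case w of (n, m) \<Rightarrow> of_int n ^ 1 * of_int m ^ 1 * (bil_coeff q n * bil_coeff q m * (x powi n * y powi m)))
      - ((case w of (n, m) \<Rightarrow> of_int (n - m) ^ 1 * of_int m ^ 1 * (bil_coeff q m * bil_coeff q (n - m) * (x powi n * y powi m)))
       + (case w of (n, m) \<Rightarrow> of_int (n - m) ^ 0 * of_int m ^ 2 * (bil_coeff q m * bil_coeff q (n - m) * (x powi n * y powi m))))
      - ((case w of (n, m) \<Rightarrow> of_int n ^ 2 * of_int (m - n) ^ 0 * (bil_coeff q n * bil_coeff q (m - n) * (x powi n * y powi m)))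
       + (case w of (n, m) \<Rightarrow> of_int n ^ 1 * of_int (m - n) ^ 1 * (bil_coeff q n * bil_coeff q (m - n) * (x powi n * y powi m)))))
     = (\<lambda>(n, m). ?K n m * (of_int n * of_int m * (x powi n * y powi m)))"
    by (auto simp: fun_eq_iff algebra_simps power2_eq_square)
  finally have 1: "((\<lambda>(n, m). ?K n m * (of_int n * of_int m * (x powi n * y powi m))) has_sum
      (bilateral q 1 x * bilateral q 1 y - (bilateral q 1 x * bilateral q 1 z + bilateral q 0 x * bilateral q 2 z) - (bilateral q 2 z * bilateral q 0 y + bilateral q 1 z * bilateral q 1 y))) UNIV" .
  have "((\<lambda>(n, m). (if m = 0 then 0 else 0) + (if n = 0 then 0 else 0)
      + (if n = m then of_int n ^ 2 * sq_coeff q n * z powi n else 0))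
     has_sum (0 + 0 + bilateral_sq q 2 z)) UNIV"
    by (intro has_sum_three_lines has_sum_bilateral_sq has_sum_0 q z z_less) auto
  also have "(\<lambda>(n, m). (if m = 0 then 0 else 0) + (if n = 0 then 0 else 0)
      + (if n = m then of_int n ^ 2 * sq_coeff q n * z powi n else 0))
      = (\<lambda>(n, m). ?K n m * (of_int n * of_int m * (x powi n * y powi m)))"
    unfolding bil_coeff_convolution[OF q] by (auto simp: fun_eq_iff z_powi power2_eq_square)
  finally show ?thesis using 1 by (simp add: has_sum_unique)
qed

end

section \<open>Lambert series and their Euler derivative\<close>

text \<open>All series in p below have this shape with a rational function F.  The point of the encoding is
  that identities between such series reduce to identities between the functions F, and that
  p d/dp acts as F(y) \<mapsto> y F'(y) together with w \<mapsto> w + 1.\<close>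
definition lambert :: "nat \<Rightarrow> (complex \<Rightarrow> complex) \<Rightarrow> complex \<Rightarrow> complex" where
  "lambert w F p = (\<Sum>n. of_nat (Suc n) ^ w * F (p ^ Suc n))"

lemma lambert_power: "lambert w F (p ^ d) = lambert w (\<lambda>y. F (y ^ d)) p"
  unfolding lambert_def by (simp only: power_mult[symmetric] mult.commute)

lemma lambert_at_0: "F 0 = 0 \<Longrightarrow> lambert w F 0 = 0"
  by (simp add: lambert_def)

lemma lambert_cong:
  assumes "0 < norm p" "norm p < 1"
  assumes "\<And>y. y \<noteq> 0 \<Longrightarrow> norm y < 1 \<Longrightarrow> F y = G y"
  shows "lambert w F p = lambert w G p"
proof -
  have "F (p ^ Suc n) = G (p ^ Suc n)" for n
    using assms(1,2) by (intro assms(3)) (auto simp: norm_power power_less_one_iff simp del: power_Suc)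
  thus ?thesis by (simp add: lambert_def)
qed

locale lambert_function =
  fixes F :: "complex \<Rightarrow> complex"
  assumes holo: "F holomorphic_on ball 0 1" and zero: "F 0 = 0"
begin

text \<open>A function vanishing at 0 is O(y), which makes F (p^n) geometrically small.\<close>
lemma linear_bound:
  assumes "r < 1"
  obtains C where "C \<ge> 0" "\<And>y. norm y \<le> r \<Longrightarrow> norm (F y) \<le> C * norm y"
proof -
  have sub: "cball 0 r \<subseteq> ball (0::complex) 1" using assms by auto
  have "compact (deriv F ` cball 0 r)"
    by (intro compact_continuous_image compact_cball holomorphic_on_imp_continuous_on
          holomorphic_on_subset[OF holomorphic_deriv[OF holo open_ball] sub])
  then obtain C where C: "\<And>y. y \<in> cball 0 r \<Longrightarrow> norm (deriv F y) \<le> C"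
    by (metis bounded_iff compact_imp_bounded imageI)
  have "norm (F y) \<le> \<bar>C\<bar> * norm y" if "norm y \<le> r" for y
  proof -
    have "norm (F y - F 0) \<le> \<bar>C\<bar> * norm (y - 0)"
    proof (rule field_differentiable_bound[where S = "cball 0 r" and f' = "deriv F"])
      fix z :: complex assume "z \<in> cball 0 r"
      thus "(F has_field_derivative deriv F z) (at z within cball 0 r)"
        using sub by (intro holomorphic_derivI[OF holo open_ball]) auto
      show "norm (deriv F z) \<le> \<bar>C\<bar>"
        using C[OF \<open>z \<in> cball 0 r\<close>] by simp
    qed (use that in \<open>auto intro: order_trans[OF norm_ge_zero]\<close>)
    thus ?thesis by (simp add: zero)
  qed
  thus ?thesis using that[of "\<bar>C\<bar>"] by auto
qed

lemma term_bound:
  assumes "r < 1"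
  obtains C where "C \<ge> 0" "\<And>n p. norm p \<le> r \<Longrightarrow>
    norm (of_nat (Suc n) ^ w * F (p ^ Suc n)) \<le> C * (real (Suc n) ^ w * r ^ Suc n)"
proof -
  obtain C where C: "C \<ge> 0" "\<And>y. norm y \<le> r \<Longrightarrow> norm (F y) \<le> C * norm y"
    using linear_bound[OF assms] by blast
  have "norm (of_nat (Suc n) ^ w * F (p ^ Suc n)) \<le> C * (real (Suc n) ^ w * r ^ Suc n)"
    if p: "norm p \<le> r" for n p
  proof -
    have r0: "r \<ge> 0" using p norm_ge_zero order_trans by blast
    have pr: "norm (p ^ Suc n) \<le> r ^ Suc n"
      unfolding norm_power using p by (intro power_mono) auto
    also have "\<dots> \<le> r ^ 1"
      using assms r0 by (intro power_decreasing) auto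
    finally have "norm (F (p ^ Suc n)) \<le> C * norm (p ^ Suc n)"
      by (intro C) auto
    also have "\<dots> \<le> C * r ^ Suc n"
      by (intro mult_left_mono pr C)
    finally have "real (Suc n) ^ w * norm (F (p ^ Suc n)) \<le> real (Suc n) ^ w * (C * r ^ Suc n)"
      by (intro mult_left_mono) auto
    thus ?thesis
      by (simp add: norm_mult norm_power mult_ac del: of_nat_Suc power_Suc)
  qed
  thus ?thesis using C(1) that by blast
qed

lemma summable_majorant:
  assumes "0 \<le> r" "r < 1"
  shows "summable (\<lambda>n. C * (real (Suc n) ^ w * r ^ Suc n))"
proof -
  have "summable (\<lambda>n. real (Suc n) ^ w * r ^ Suc n)"
    using summable_power_times_geometric[OF assms, of w]
      summable_Suc_iff[of "\<lambda>n. real n ^ w * r ^ n"] by blast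
  thus ?thesis by (rule summable_mult)
qed

lemma lambert_summable:
  assumes "norm p < 1"
  shows "summable (\<lambda>n. of_nat (Suc n) ^ w * F (p ^ Suc n))"
proof -
  obtain C where "\<And>n. norm (of_nat (Suc n) ^ w * F (p ^ Suc n)) \<le> C * (real (Suc n) ^ w * norm p ^ Suc n)"
    using term_bound[OF assms, of w] by (metis order_refl)
  thus ?thesis
    by (intro summable_comparison_test'[OF summable_majorant[OF norm_ge_zero assms], of 0])
qed

lemma lambert_sums:
  assumes "norm p < 1"
  shows "(\<lambda>n. of_nat (Suc n) ^ w * F (p ^ Suc n)) sums lambert w F p"
  unfolding lambert_def by (intro summable_sums lambert_summable assms)

text \<open>On a disc of radius r < 1 the series is dominated by a convergent series that does not depend
  on p, so it may be differentiated term by term.\<close>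
lemma lambert_termwise_deriv:
  assumes "norm p < 1"
  shows "lambert w F field_differentiable (at p)"
    and "(\<lambda>n. of_nat (Suc n) ^ w * (deriv F (p ^ Suc n) * (of_nat (Suc n) * p ^ n)))
           sums deriv (lambert w F) p"
proof -
  define f where "f = (\<lambda>n p. of_nat (Suc n) ^ w * F (p ^ Suc n))"
  define f' where "f' = (\<lambda>n p. of_nat (Suc n) ^ w * (deriv F (p ^ Suc n) * (of_nat (Suc n) * p ^ n)))"
  have "\<exists>g g'. \<forall>x\<in>ball 0 1. (\<lambda>n. f n x) sums g x \<and> (\<lambda>n. f' n x) sums g' x \<and> (g has_field_derivative g' x) (at x)"
  proof (rule series_and_derivative_comparison_complex[OF open_ball])
    fix n :: nat and x :: complex assume x: "x \<in> ball 0 1"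
    hence "norm x ^ Suc n < 1" by (subst power_less_one_iff) auto
    hence "(F has_field_derivative deriv F (x ^ Suc n)) (at (x ^ Suc n))"
      by (intro holomorphic_derivI[OF holo open_ball]) (auto simp: norm_mult norm_power)
    hence "((\<lambda>x. F (x ^ Suc n)) has_field_derivative deriv F (x ^ Suc n) * (of_nat (Suc n) * x ^ n)) (at x)"
      by (rule DERIV_chain'[rotated]) (auto intro!: derivative_eq_intros simp del: power_Suc of_nat_Suc)
    thus "(f n has_field_derivative f' n x) (at x)"
      unfolding f_def f'_def by (rule DERIV_cmult)
  next
    fix x :: complex assume x: "x \<in> ball 0 1"
    define r where "r = (norm x + 1) / 2"
    have r: "0 \<le> r" "r < 1" "norm x < r" using x by (auto simp: r_def)
    obtain C where C: "C \<ge> 0" "\<And>n p. norm p \<le> r \<Longrightarrow> norm (f n p) \<le> C * (real (Suc n) ^ w * r ^ Suc n)"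
      unfolding f_def using term_bound[OF r(2), of w] by blast
    define h where "h = (\<lambda>n. complex_of_real (C * (real (Suc n) ^ w * r ^ Suc n)))"
    have "r - norm x > 0" using r by simp
    moreover have "summable h"
      unfolding h_def by (intro summable_of_real summable_majorant r)
    moreover have "range h \<subseteq> \<real>\<^sub>\<ge>\<^sub>0"
      using C(1) r(1) by (auto simp: h_def simp del: of_real_mult of_real_power of_nat_Suc power_Suc)
    moreover have "\<forall>\<^sub>F n in sequentially. \<forall>y\<in>ball x (r - norm x) \<inter> ball 0 1. norm (f n y) \<le> norm (h n)"
    proof (intro always_eventually allI ballI)
      fix n y assume "y \<in> ball x (r - norm x) \<inter> ball 0 1"
      hence "norm y \<le> r"
        using norm_triangle_ineq2[of y x] by (auto simp: dist_norm norm_minus_commute)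
      thus "norm (f n y) \<le> norm (h n)"
        using C(2)[of y n] C(1) r(1)
        by (simp add: h_def abs_mult del: of_real_mult of_real_power of_nat_Suc power_Suc)
    qed
    ultimately show "\<exists>d (h :: nat \<Rightarrow> complex). 0 < d \<and> summable h \<and> range h \<subseteq> \<real>\<^sub>\<ge>\<^sub>0 \<and>
        (\<forall>\<^sub>F n in sequentially. \<forall>y\<in>ball x d \<inter> ball 0 1. norm (f n y) \<le> norm (h n))"
      by (intro exI[of _ "r - norm x"] exI[of _ h] conjI)
  qed
  then obtain g g' where g: "\<And>x. x \<in> ball 0 1 \<Longrightarrow> (\<lambda>n. f n x) sums g x"
    "\<And>x. x \<in> ball 0 1 \<Longrightarrow> (\<lambda>n. f' n x) sums g' x"
    "\<And>x. x \<in> ball 0 1 \<Longrightarrow> (g has_field_derivative g' x) (at x)" by blast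
  have p: "p \<in> ball 0 1" using assms by simp
  have "g x = lambert w F x" if "x \<in> ball 0 1" for x
    using sums_unique[OF g(1)[OF that]] by (simp add: lambert_def f_def)
  hence D: "(lambert w F has_field_derivative g' p) (at p)"
    by (rule has_field_derivative_transform_within_open[OF g(3)[OF p] open_ball p])
  thus "lambert w F field_differentiable (at p)"
    by (auto simp: field_differentiable_def)
  show "(\<lambda>n. of_nat (Suc n) ^ w * (deriv F (p ^ Suc n) * (of_nat (Suc n) * p ^ n))) sums deriv (lambert w F) p"
    using g(2)[OF p] DERIV_imp_deriv[OF D] by (simp add: f'_def)
qed

lemma lambert_has_deriv:
  "norm p < 1 \<Longrightarrow> (lambert w F has_field_derivative deriv (lambert w F) p) (at p)"
  using lambert_termwise_deriv(1) field_differentiable_derivI by blast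

lemma euler_deriv_lambert:
  assumes "norm p < 1"
  shows "p * deriv (lambert w F) p = lambert (Suc w) (\<lambda>y. y * deriv F y) p"
proof -
  have "(\<lambda>n. p * (of_nat (Suc n) ^ w * (deriv F (p ^ Suc n) * (of_nat (Suc n) * p ^ n)))) sums (p * deriv (lambert w F) p)"
    by (intro sums_mult lambert_termwise_deriv assms)
  also have "(\<lambda>n. p * (of_nat (Suc n) ^ w * (deriv F (p ^ Suc n) * (of_nat (Suc n) * p ^ n))))
      = (\<lambda>n. of_nat (Suc n) ^ Suc w * (p ^ Suc n * deriv F (p ^ Suc n)))"
    by (simp add: mult_ac)
  finally show ?thesis
    unfolding lambert_def[of "Suc w"] by (rule sums_unique)
qed

lemma deriv_lambert_0: "deriv (lambert w F) 0 = deriv F 0"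
proof -
  have "(\<lambda>n. of_nat (Suc n) ^ w * (deriv F (0 ^ Suc n) * (of_nat (Suc n) * 0 ^ n))) sums deriv (lambert w F) 0"
    by (intro lambert_termwise_deriv) auto
  moreover have "(\<lambda>n. of_nat (Suc n) ^ w * (deriv F (0 ^ Suc n) * (of_nat (Suc n) * 0 ^ n))) sums
      (\<Sum>n\<in>{0}. of_nat (Suc n) ^ w * (deriv F (0 ^ Suc n) * (of_nat (Suc n) * 0 ^ n)))"
    by (intro sums_finite) auto
  ultimately show ?thesis by (auto dest: sums_unique2)
qed

lemma lambert_tendsto_0: "(lambert w F \<longlongrightarrow> 0) (at 0)"
  using DERIV_isCont[OF lambert_has_deriv[of 0 w]] lambert_at_0[where F = F and w = w, OF zero]
  by (simp add: isCont_def)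

end

lemma lambert_add:
  assumes "lambert_function F" "lambert_function G" "norm p < 1"
  shows "lambert w (\<lambda>y. F y + G y) p = lambert w F p + lambert w G p"
  using sums_add[OF lambert_function.lambert_sums[OF assms(1,3), of w]
       lambert_function.lambert_sums[OF assms(2,3), of w]]
  by (simp add: lambert_def sums_iff algebra_simps)

lemma lambert_cmult:
  assumes "lambert_function F" "norm p < 1"
  shows "lambert w (\<lambda>y. c * F y) p = c * lambert w F p"
  using sums_mult[OF lambert_function.lambert_sums[OF assms, of w], of c]
  by (simp add: lambert_def sums_iff algebra_simps)

lemma lambert_diff:
  assumes "lambert_function F" "lambert_function G" "norm p < 1"
  shows "lambert w (\<lambda>y. F y - G y) p = lambert w F p - lambert w G p"
  using sums_diff[OF lambert_function.lambert_sums[OF assms(1,3), of w]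
       lambert_function.lambert_sums[OF assms(2,3), of w]]
  by (simp add: lambert_def sums_iff algebra_simps)

lemma lambert_function_add: "lambert_function F \<Longrightarrow> lambert_function G \<Longrightarrow> lambert_function (\<lambda>y. F y + G y)"
  by (auto simp: lambert_function_def intro!: holomorphic_intros)
lemma lambert_function_diff: "lambert_function F \<Longrightarrow> lambert_function G \<Longrightarrow> lambert_function (\<lambda>y. F y - G y)"
  by (auto simp: lambert_function_def intro!: holomorphic_intros)
lemma lambert_function_cmult: "lambert_function F \<Longrightarrow> lambert_function (\<lambda>y. c * F y)"
  by (auto simp: lambert_function_def intro!: holomorphic_intros)

lemmas lambert_linearity = lambert_add lambert_diff lambert_cmult
  lambert_function_add lambert_function_diff lambert_function_cmult

lemma one_minus_power_neq_0:
  fixes y :: complex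
  assumes "norm y < 1" "d > 0"
  shows "1 - y ^ d \<noteq> 0"
proof
  assume "1 - y ^ d = 0"
  hence "norm (y ^ d) = 1" by (metis eq_iff_diff_eq_0 norm_one)
  thus False using assms power_less_one_iff[of "norm y" d] by (simp add: norm_power)
qed

lemma lambert_function_powers:
  assumes "0 < k" "0 < l" "0 < d"
  shows "lambert_function (\<lambda>y. (y ^ k + c * y ^ l) / (1 - y ^ d) ^ e)"
  using assms one_minus_power_neq_0[of _ d]
  by unfold_locales (auto intro!: holomorphic_intros simp: zero_power)

section \<open>Evaluation at powers of a sixth root of the period\<close>

text \<open>The terms of the bilateral series at x = p^k, q = p^6 after pairing n with -n, as functions of
  y = p^n.  Which of the four occurs depends on the parity of the exponent j.\<close>
definition geom_diff :: "nat \<Rightarrow> complex \<Rightarrow> complex" where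
  "geom_diff k y = (y ^ k - y ^ (6 - k)) / (1 - y ^ 6)"
definition geom_sum :: "nat \<Rightarrow> complex \<Rightarrow> complex" where
  "geom_sum k y = (y ^ k + y ^ (6 - k)) / (1 - y ^ 6)"
definition sq_sum :: "nat \<Rightarrow> complex \<Rightarrow> complex" where
  "sq_sum k y = (y ^ (6 - k) + y ^ (6 + k)) / (1 - y ^ 6)\<^sup>2"
definition sq_diff :: "nat \<Rightarrow> complex \<Rightarrow> complex" where
  "sq_diff k y = (y ^ (6 - k) - y ^ (6 + k)) / (1 - y ^ 6)\<^sup>2"

lemma lambert_function_level6:
  assumes "0 < k" "k < 6"
  shows "lambert_function (geom_diff k)" "lambert_function (geom_sum k)"
    "lambert_function (sq_sum k)" "lambert_function (sq_diff k)"
  using lambert_function_powers[of k "6 - k" 6 "-1" 1] lambert_function_powers[of k "6 - k" 6 1 1]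
    lambert_function_powers[of "6 - k" "6 + k" 6 1 2] lambert_function_powers[of "6 - k" "6 + k" 6 "-1" 2] assms
  unfolding geom_diff_def geom_sum_def sq_sum_def sq_diff_def by simp_all

locale punctured_disc =
  fixes p :: complex
  assumes p: "0 < norm p" "norm p < 1"
begin

lemma p6: "p ^ 6 \<noteq> 0" "norm (p ^ 6) < 1"
  using p by (auto simp: norm_power power_less_one_iff)

lemma in_annulus:
  assumes "0 < k" "k < 6"
  shows "norm (p ^ 6) < norm (p ^ k)" "norm (p ^ k) < 1"
  using p assms by (auto simp: norm_power power_less_one_iff intro: power_strict_decreasing)

text \<open>The hypothesis on F is the result of pairing n with -n.\<close>
lemma bilateral_to_lambert:
  assumes "(\<lambda>n. norm (of_int n ^ j * c n * (p ^ k) powi n)) summable_on UNIV"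
    and "\<And>n. n > 0 \<Longrightarrow> c (int n) * (p ^ n) ^ k + (- 1) ^ j * c (- int n) / (p ^ n) ^ k = F (p ^ n)"
  shows "(\<Sum>\<^sub>\<infinity>n. of_int n ^ j * c n * (p ^ k) powi n) = 0 ^ j * c 0 + lambert j F p"
proof -
  have p0: "p \<noteq> 0" using p by auto
  define G where "G = (\<lambda>n. of_int n ^ j * c n * (p ^ k) powi n)"
  have eq: "(\<lambda>n::nat. G (int (Suc n)) + G (- int (Suc n))) = (\<lambda>n. of_nat (Suc n) ^ j * F (p ^ Suc n))"
  proof
    fix n :: nat
    define m where "m = Suc n"
    have "(p ^ k) ^ m = (p ^ m) ^ k"
      by (simp only: power_mult[symmetric] mult.commute)
    hence "(p ^ k) powi (int m) = (p ^ m) ^ k" "(p ^ k) powi (- int m) = inverse ((p ^ m) ^ k)"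
      by (simp_all add: power_int_minus)
    moreover have "of_int (- int m) ^ j = (- 1) ^ j * (of_nat m ^ j :: complex)"
      by (simp add: power_mult_distrib[symmetric])
    ultimately have "G (int m) + G (- int m) =
        of_nat m ^ j * (c (int m) * (p ^ m) ^ k + (- 1) ^ j * c (- int m) / (p ^ m) ^ k)"
      unfolding G_def by (simp add: divide_inverse algebra_simps)
    also have "\<dots> = of_nat m ^ j * F (p ^ m)"
      by (subst assms(2)) (auto simp: m_def)
    finally show "G (int (Suc n)) + G (- int (Suc n)) = of_nat (Suc n) ^ j * F (p ^ Suc n)"
      unfolding m_def .
  qed
  have "G summable_on UNIV"
    unfolding G_def by (rule abs_summable_summable[OF assms(1)])
  from has_sum_imp_sums[OF has_sum_int_nat[OF this, unfolded eq]]
  have "lambert j F p = infsum G UNIV - G 0"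
    by (simp add: lambert_def sums_iff)
  thus ?thesis by (simp add: G_def)
qed

lemma power_nonzero: "n > 0 \<Longrightarrow> p ^ n \<noteq> 0 \<and> norm (p ^ n) < 1"
  using p by (auto simp: norm_power power_less_one_iff)

lemma level6_coeffs:
  assumes "n > 0"
  shows "bil_coeff (p ^ 6) (int n) = 1 / (1 - (p ^ n) ^ 6)"
    and "bil_coeff (p ^ 6) (- int n) = - ((p ^ n) ^ 6 / (1 - (p ^ n) ^ 6))"
    and "sq_coeff (p ^ 6) (int n) = (p ^ n) ^ 6 / (1 - (p ^ n) ^ 6)\<^sup>2"
    and "sq_coeff (p ^ 6) (- int n) = (p ^ n) ^ 6 / (1 - (p ^ n) ^ 6)\<^sup>2"
proof -
  have pw: "(p ^ 6) ^ n = (p ^ n) ^ 6"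
    by (metis power_mult mult.commute)
  have nz: "1 - (p ^ n) ^ 6 \<noteq> 0"
    using one_minus_power_neq_0[of "p ^ n" 6] power_nonzero[OF assms] by simp
  show b1: "bil_coeff (p ^ 6) (int n) = 1 / (1 - (p ^ n) ^ 6)"
    using assms by (simp add: bil_coeff_def pw)
  show b2: "bil_coeff (p ^ 6) (- int n) = - ((p ^ n) ^ 6 / (1 - (p ^ n) ^ 6))"
    unfolding bil_coeff_minus[OF p6] b1 using nz by (simp add: field_simps)
  show s1: "sq_coeff (p ^ 6) (int n) = (p ^ n) ^ 6 / (1 - (p ^ n) ^ 6)\<^sup>2"
    using assms by (simp add: sq_coeff_def pw)
  show "sq_coeff (p ^ 6) (- int n) = (p ^ n) ^ 6 / (1 - (p ^ n) ^ 6)\<^sup>2"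
    unfolding s1[symmetric] using assms
    by (simp add: sq_coeff_eq[OF p6] bil_coeff_minus[OF p6] algebra_simps)
qed

lemma power_6_diff:
  assumes "y \<noteq> (0::complex)" "k \<le> 6"
  shows "y ^ 6 / y ^ k = y ^ (6 - k)"
  using assms by (simp add: power_diff)

lemma bilateral_0: assumes "0 < k" "k < 6" shows "bilateral (p ^ 6) 0 (p ^ k) = 1 / 2 + lambert 0 (geom_diff k) p"
  unfolding bilateral_def
  by (subst bilateral_to_lambert[where F = "geom_diff k", OF bilateral_summable[OF p6 in_annulus[OF assms]]])
     (use assms power_nonzero in \<open>auto simp: level6_coeffs geom_diff_def bil_coeff_def[of _ 0] diff_divide_distrib power_6_diff[symmetric]\<close>)

lemma bilateral_1: assumes "0 < k" "k < 6" shows "bilateral (p ^ 6) 1 (p ^ k) = lambert 1 (geom_sum k) p"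
  unfolding bilateral_def
  by (subst bilateral_to_lambert[where F = "geom_sum k", OF bilateral_summable[OF p6 in_annulus[OF assms]]])
     (use assms power_nonzero in \<open>auto simp: level6_coeffs geom_sum_def add_divide_distrib power_6_diff[symmetric]\<close>)

lemma bilateral_2: assumes "0 < k" "k < 6" shows "bilateral (p ^ 6) 2 (p ^ k) = lambert 2 (geom_diff k) p"
  unfolding bilateral_def
  by (subst bilateral_to_lambert[where F = "geom_diff k", OF bilateral_summable[OF p6 in_annulus[OF assms]]])
     (use assms power_nonzero in \<open>auto simp: level6_coeffs geom_diff_def diff_divide_distrib power_6_diff[symmetric]\<close>)

lemma bilateral_sq_0: assumes "0 < k" "k < 6" shows "bilateral_sq (p ^ 6) 0 (p ^ k) = lambert 0 (sq_sum k) p"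
  unfolding bilateral_sq_def
  by (subst bilateral_to_lambert[where F = "sq_sum k", OF bilateral_sq_summable[OF p6 in_annulus[OF assms]]])
     (use assms power_nonzero in \<open>auto simp: level6_coeffs sq_sum_def sq_coeff_def[of _ 0] add_divide_distrib power_6_diff[symmetric] power_add\<close>)

lemma bilateral_sq_1: assumes "0 < k" "k < 6" shows "bilateral_sq (p ^ 6) 1 (p ^ k) = - lambert 1 (sq_diff k) p"
proof -
  have "bilateral_sq (p ^ 6) 1 (p ^ k) = 0 ^ 1 * sq_coeff (p ^ 6) 0 + lambert 1 (\<lambda>y. - 1 * sq_diff k y) p"
    unfolding bilateral_sq_def
    by (rule bilateral_to_lambert[OF bilateral_sq_summable[OF p6 in_annulus[OF assms]]])
       (use assms power_nonzero in \<open>auto simp: level6_coeffs sq_diff_def diff_divide_distrib power_6_diff[symmetric] power_add\<close>)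
  thus ?thesis
    using lambert_cmult[OF lambert_function_level6(4)[OF assms] p(2), of 1 "- 1"] by simp
qed

lemma bilateral_sq_2: assumes "0 < k" "k < 6" shows "bilateral_sq (p ^ 6) 2 (p ^ k) = lambert 2 (sq_sum k) p"
  unfolding bilateral_sq_def
  by (subst bilateral_to_lambert[where F = "sq_sum k", OF bilateral_sq_summable[OF p6 in_annulus[OF assms]]])
     (use assms power_nonzero in \<open>auto simp: level6_coeffs sq_sum_def sq_coeff_def[of _ 0] add_divide_distrib power_6_diff[symmetric] power_add\<close>)

text \<open>The points p^k and p^(6-k) are inverse to each other modulo the period, so their series agree
  up to the shift by one period.\<close>
lemma lambert_sq_sum_reflect:
  assumes "0 < k" "k < 6"
  shows "lambert w (sq_sum (6 - k)) p = lambert w (sq_sum k) p + lambert w (geom_diff k) p"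
proof -
  have "sq_sum (6 - k) y = sq_sum k y + geom_diff k y" if "norm y < 1" for y
  proof -
    have "1 - y ^ 6 \<noteq> 0" using one_minus_power_neq_0[OF that, of 6] by simp
    hence "geom_diff k y = (y ^ k - y ^ (6 - k)) * (1 - y ^ 6) / (1 - y ^ 6)\<^sup>2"
      by (simp add: geom_diff_def power2_eq_square)
    moreover have "y ^ (6 + k) = y ^ 6 * y ^ k" "y ^ (6 + (6 - k)) = y ^ 6 * y ^ (6 - k)"
      by (simp_all add: power_add)
    moreover have "6 - (6 - k) = k" using assms by simp
    ultimately show ?thesis
      unfolding sq_sum_def by (simp add: add_divide_distrib[symmetric] algebra_simps)
  qed
  hence "lambert w (sq_sum (6 - k)) p = lambert w (\<lambda>y. sq_sum k y + geom_diff k y) p"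
    by (intro lambert_cong p) auto
  thus ?thesis
    using lambert_add[OF lambert_function_level6(3)[OF assms] lambert_function_level6(1)[OF assms] p(2)] by simp
qed

lemma annulus_pair:
  assumes "0 < k" "0 < l" "k + l < 6"
  shows "annulus_pair (p ^ 6) (p ^ k) (p ^ l) (p ^ (k + l))"
  using in_annulus[of k] in_annulus[of l] in_annulus[of "k + l"] assms p6
  by unfold_locales (auto simp: power_add)

lemma lambert_addition:
  assumes "0 < k" "0 < l" "k + l < 6"
  defines "rho \<equiv> \<lambda>k. 1 / 2 + lambert 0 (geom_diff k) p"
  defines "sig \<equiv> \<lambda>k. lambert 1 (geom_sum k) p"
  defines "kap \<equiv> \<lambda>k. lambert 2 (geom_diff k) p"
  shows "rho k * rho l - rho k * rho (k + l) - rho (k + l) * rho l =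
           lambert 0 (sq_sum k) p + lambert 0 (sq_sum l) p + lambert 0 (sq_sum (k + l)) p - 1 / 4"
    and "sig k * rho l - (rho k * sig (k + l) + sig k * rho (k + l)) - sig (k + l) * rho l =
           - lambert 1 (sq_diff k) p - lambert 1 (sq_diff (k + l)) p"
    and "sig k * sig l - (sig k * sig (k + l) + rho k * kap (k + l))
           - (kap (k + l) * rho l + sig (k + l) * sig l) = lambert 2 (sq_sum (k + l)) p"
proof -
  have k: "k < 6" "l < 6" "0 < k + l" using assms by auto
  note b = annulus_pair.bilateral_addition[OF annulus_pair[OF assms(1-3)]]
    annulus_pair.bilateral_addition_deriv[OF annulus_pair[OF assms(1-3)]]
    annulus_pair.bilateral_addition_deriv2[OF annulus_pair[OF assms(1-3)]]
  note c = bilateral_0[OF assms(1) k(1)] bilateral_0[OF assms(2) k(2)] bilateral_0[OF k(3) assms(3)]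
    bilateral_1[OF assms(1) k(1)] bilateral_1[OF assms(2) k(2)] bilateral_1[OF k(3) assms(3)] bilateral_2[OF k(3) assms(3)]
    bilateral_sq_0[OF assms(1) k(1)] bilateral_sq_0[OF assms(2) k(2)] bilateral_sq_0[OF k(3) assms(3)]
    bilateral_sq_1[OF assms(1) k(1)] bilateral_sq_1[OF k(3) assms(3)] bilateral_sq_2[OF k(3) assms(3)]
  show "rho k * rho l - rho k * rho (k + l) - rho (k + l) * rho l =
           lambert 0 (sq_sum k) p + lambert 0 (sq_sum l) p + lambert 0 (sq_sum (k + l)) p - 1 / 4"
    using b(1) unfolding c rho_def .
  show "sig k * rho l - (rho k * sig (k + l) + sig k * rho (k + l)) - sig (k + l) * rho l =
           - lambert 1 (sq_diff k) p - lambert 1 (sq_diff (k + l)) p"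
    using b(2) unfolding c rho_def sig_def by simp
  show "sig k * sig l - (sig k * sig (k + l) + rho k * kap (k + l))
           - (kap (k + l) * rho l + sig (k + l) * sig l) = lambert 2 (sq_sum (k + l)) p"
    using b(3) unfolding c rho_def sig_def kap_def .
qed

text \<open>Weight one at p and p^2; weight two, in two versions, at p, p^2 and p^3.  The m-series are,
  up to scaling and multiples of the r-series, logarithmic derivatives of theta values with respect
  to p, while the s-series are values of a Weierstrass function up to sign and a common
  quasimodular summand.\<close>
abbreviation "r1 \<equiv> lambert 0 (geom_diff 1) p"
abbreviation "r2 \<equiv> lambert 0 (geom_diff 2) p"
abbreviation "s1 \<equiv> lambert 1 (geom_sum 1) p"
abbreviation "s2 \<equiv> lambert 1 (geom_sum 2) p"
abbreviation "s3 \<equiv> lambert 1 (geom_sum 3) p"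
abbreviation "m1 \<equiv> lambert 0 (sq_sum 1) p"
abbreviation "m2 \<equiv> lambert 0 (sq_sum 2) p"
abbreviation "m3 \<equiv> lambert 0 (sq_sum 3) p"

text \<open>The logarithmic derivative of theta is odd and so vanishes at the half period p^3.\<close>
lemma geom_diff_3: "geom_diff 3 = (\<lambda>_. 0)"
  by (simp add: geom_diff_def fun_eq_iff)

lemma lambert_zero [simp]: "lambert w (\<lambda>_. 0) x = 0"
  by (simp add: lambert_def)

lemma geom_diff_4: "lambert w (geom_diff 4) p = - lambert w (geom_diff 2) p"
proof -
  have "geom_diff 4 = (\<lambda>y. - 1 * geom_diff 2 y)"
    by (auto simp: geom_diff_def fun_eq_iff minus_divide_left)
  thus ?thesis
    using lambert_cmult[OF lambert_function_level6(1)[of 2] p(2), of w "- 1"] by simp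
qed

text \<open>The addition formula at (p^2, p^2), (p, p) and (p, p^2) gives three equations for the three
  series m1, m2, m3.\<close>
lemma weight2_relations:
  "m2 = r2\<^sup>2"
  "2 * m1 + m2 = r1\<^sup>2 - 2 * r1 * r2 - r2"
  "m1 + m2 + m3 = r1 * r2"
proof -
  have sq4: "lambert w (sq_sum 4) p = lambert w (sq_sum 2) p + lambert w (geom_diff 2) p" for w
    using lambert_sq_sum_reflect[of 2 w] by simp
  show "m2 = r2\<^sup>2"
    using lambert_addition(1)[of 2 2] by (simp add: geom_diff_4 sq4 power2_eq_square algebra_simps del: One_nat_def)
  show "2 * m1 + m2 = r1\<^sup>2 - 2 * r1 * r2 - r2"
    using lambert_addition(1)[of 1 1] by (simp add: power2_eq_square algebra_simps del: One_nat_def)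
  show "m1 + m2 + m3 = r1 * r2"
    using lambert_addition(1)[of 1 2] by (simp add: geom_diff_3 algebra_simps del: One_nat_def)
qed

lemma sq_diff_3: "lambert 1 (sq_diff 3) p = s3 / 2"
proof -
  have "2 * sq_diff 3 y = geom_sum 3 y" if "norm y < 1" for y
  proof -
    have nz: "1 - y ^ 6 \<noteq> 0" using one_minus_power_neq_0[OF that, of 6] by simp
    hence "geom_sum 3 y = 2 * y ^ 3 * (1 - y ^ 6) / (1 - y ^ 6)\<^sup>2"
      by (simp add: geom_sum_def power2_eq_square)
    also have "2 * y ^ 3 * (1 - y ^ 6) = 2 * (y ^ 3 - y ^ 9)"
      by (simp add: algebra_simps flip: power_add)
    finally show ?thesis by (simp add: sq_diff_def)
  qed
  hence "lambert 1 (\<lambda>y. 2 * sq_diff 3 y) p = s3"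
    by (intro lambert_cong p) auto
  thus ?thesis
    using lambert_cmult[OF lambert_function_level6(4)[of 3] p(2), of 1 2] by simp
qed

text \<open>The derived addition formula at (p, p^2) and (p^2, p), where z is the half period p^3 in both
  cases.\<close>
lemma weight3_relations:
  "lambert 1 (sq_diff 1) p = s3 * (r1 + r2 + 1 / 2) - s1 * r2"
  "lambert 1 (sq_diff 2) p = s3 * (r1 + r2 + 1 / 2) - s2 * r1"
proof -
  show "lambert 1 (sq_diff 1) p = s3 * (r1 + r2 + 1 / 2) - s1 * r2"
    using lambert_addition(2)[of 1 2] by (simp add: geom_diff_3 sq_diff_3 algebra_simps del: One_nat_def)
  show "lambert 1 (sq_diff 2) p = s3 * (r1 + r2 + 1 / 2) - s2 * r1"
    using lambert_addition(2)[of 2 1] by (simp add: geom_diff_3 sq_diff_3 algebra_simps del: One_nat_def)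
qed

text \<open>At the half period the odd second derivative also vanishes, so the mixed derivative of the
  addition formula at (p, p^2) closes up.\<close>
lemma weight4_relation: "lambert 2 (sq_sum 3) p = s1 * s2 - s3 * (s1 + s2)"
  using lambert_addition(3)[of 1 2] by (simp add: geom_diff_3 algebra_simps del: One_nat_def)

end

section \<open>Divisor sums and the differential system of level 6\<close>
lemma summable_lambert_double:
  fixes p :: complex
  assumes "norm p < 1"
  shows "(\<lambda>(n, m). of_nat (Suc n) * p ^ (Suc n * Suc m)) summable_on (UNIV :: (nat \<times> nat) set)"
proof -
  have 1: "(\<lambda>n. norm (of_nat (Suc n) * p ^ n)) summable_on UNIV"
  proof -
    have "summable (\<lambda>n. real n ^ 1 * norm p ^ n + norm p ^ n)"
      by (intro summable_add summable_power_times_geometric summable_geometric) (use assms in auto)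
    also have "(\<lambda>n. real n ^ 1 * norm p ^ n + norm p ^ n) = (\<lambda>n. norm (of_nat (Suc n) * p ^ n))"
      unfolding norm_mult norm_of_nat norm_power by (simp add: algebra_simps)
    finally show ?thesis by (subst summable_on_UNIV_nonneg_real_iff) auto
  qed
  have 2: "(\<lambda>m. norm (p ^ m)) summable_on UNIV"
    using assms by (subst summable_on_UNIV_nonneg_real_iff) (auto simp: norm_power summable_geometric)
  have "(\<lambda>z. norm (case z of (n, m) \<Rightarrow> of_nat (Suc n) * p ^ n * p ^ m)) summable_on (UNIV \<times> UNIV)"
    by (rule abs_summable_times_product[OF 1 2])
  hence "(\<lambda>z. norm (case z of (n, m) \<Rightarrow> of_nat (Suc n) * p ^ (Suc n * Suc m))) summable_on (UNIV \<times> UNIV)"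
  proof (rule Infinite_Sum.abs_summable_on_comparison_test[where g = "\<lambda>(n, m). of_nat (Suc n) * p ^ n * p ^ m"])
    fix z :: "nat \<times> nat"
    obtain n m where z: "z = (n, m)" by (cases z)
    have "norm p ^ (Suc n * Suc m) \<le> norm p ^ (n + m)"
      using assms by (intro power_decreasing) auto
    thus "norm (case z of (n, m) \<Rightarrow> of_nat (Suc n) * p ^ (Suc n * Suc m)) \<le> norm (case z of (n, m) \<Rightarrow> of_nat (Suc n) * p ^ n * p ^ m)"
      unfolding z by (simp add: norm_mult norm_power power_add mult_left_mono mult.assoc del: of_nat_Suc power_Suc mult_Suc mult_Suc_right)
  qed
  hence "(\<lambda>(n, m). of_nat (Suc n) * p ^ (Suc n * Suc m)) summable_on (UNIV \<times> UNIV)"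
    by (rule abs_summable_summable)
  thus ?thesis by simp
qed

text \<open>Both sides are the double series \<Sum> n p^(n m), summed by rows and by columns.  The first form
  comes from logarithmic derivatives of products, the second from the m-series.\<close>
lemma lambert_transpose_1:
  assumes "norm p < 1"
  shows "lambert 1 (\<lambda>y. y / (1 - y)) p = lambert 0 (\<lambda>y. y / (1 - y)\<^sup>2) p"
proof -
  let ?f = "\<lambda>n m. of_nat (Suc n) * p ^ (Suc n * Suc m)"
  have sm: "(\<lambda>(n, m). ?f n m) summable_on (UNIV \<times> UNIV)"
    using summable_lambert_double[OF assms] by simp
  have pn: "norm (p ^ Suc n) < 1" for n
    using assms by (simp add: norm_power power_less_one_iff del: power_Suc)
  have row: "(\<Sum>\<^sub>\<infinity>m. ?f n m) = of_nat (Suc n) ^ 1 * (p ^ Suc n / (1 - p ^ Suc n))" for n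
  proof -
    define y where "y = p ^ Suc n"
    have y: "norm y < 1" unfolding y_def by (rule pn)
    have "(\<lambda>m. y ^ Suc m) sums (y / (1 - y))"
      using sums_mult[OF geometric_sums[OF y], of y] by simp
    moreover have "summable (\<lambda>m. norm (y ^ Suc m))"
      using y by (simp add: norm_mult norm_power summable_mult summable_geometric)
    ultimately have "((\<lambda>m. y ^ Suc m) has_sum (y / (1 - y))) UNIV"
      by (intro norm_summable_imp_has_sum)
    hence "((\<lambda>m. of_nat (Suc n) * y ^ Suc m) has_sum (of_nat (Suc n) * (y / (1 - y)))) UNIV"
      by (rule has_sum_cmult_right)
    thus ?thesis
      by (simp only: y_def power_mult[symmetric] power_one_right infsumI)
  qed
  have col: "(\<Sum>\<^sub>\<infinity>n. ?f n m) = of_nat (Suc m) ^ 0 * (p ^ Suc m / (1 - p ^ Suc m)\<^sup>2)" for m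
  proof -
    define y where "y = p ^ Suc m"
    have y: "norm y < 1" unfolding y_def by (rule pn)
    have "(\<lambda>n. of_nat (Suc n) * y ^ n) sums (1 / (1 - y)\<^sup>2)"
      using geometric_deriv_sums[OF y] by (simp add: diffs_def)
    hence "(\<lambda>n. y * (of_nat (Suc n) * y ^ n)) sums (y * (1 / (1 - y)\<^sup>2))"
      by (rule sums_mult)
    moreover have "(\<lambda>n. y * (of_nat (Suc n) * y ^ n)) = (\<lambda>n. of_nat (Suc n) * y ^ Suc n)"
      by (auto simp: mult_ac)
    ultimately have "(\<lambda>n. of_nat (Suc n) * y ^ Suc n) sums (y / (1 - y)\<^sup>2)"
      by simp
    moreover have "summable (\<lambda>n. norm (of_nat (Suc n) * y ^ Suc n))"
      using summable_Suc_iff[THEN iffD2, OF summable_power_times_geometric[OF norm_ge_zero y, of 1]]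
      by (simp add: norm_mult norm_power del: of_nat_Suc power_Suc)
    ultimately have "((\<lambda>n. of_nat (Suc n) * y ^ Suc n) has_sum (y / (1 - y)\<^sup>2)) UNIV"
      by (intro norm_summable_imp_has_sum)
    thus ?thesis
      by (simp only: y_def power_mult[symmetric] mult.commute[of "Suc m"] power_0 mult_1 infsumI)
  qed
  have "(\<Sum>\<^sub>\<infinity>n. \<Sum>\<^sub>\<infinity>m. ?f n m) = (\<Sum>\<^sub>\<infinity>m. \<Sum>\<^sub>\<infinity>n. ?f n m)"
    by (rule infsum_swap_banach[OF sm])
  hence eq: "(\<Sum>\<^sub>\<infinity>n. of_nat (Suc n) ^ 1 * (p ^ Suc n / (1 - p ^ Suc n))) =
    (\<Sum>\<^sub>\<infinity>m. of_nat (Suc m) ^ 0 * (p ^ Suc m / (1 - p ^ Suc m)\<^sup>2))"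
    unfolding row col .
  have "(\<lambda>n. \<Sum>\<^sub>\<infinity>m. ?f n m) summable_on UNIV"
    by (rule summable_on_Sigma_banach[OF sm])
  hence s1: "(\<lambda>n. of_nat (Suc n) ^ 1 * (p ^ Suc n / (1 - p ^ Suc n))) summable_on UNIV"
    unfolding row .
  have "(\<lambda>(m, n). ?f n m) summable_on (UNIV \<times> UNIV)"
    using summable_on_reindex_bij_witness[of UNIV prod.swap prod.swap UNIV "\<lambda>(m, n). ?f n m" "\<lambda>(n, m). ?f n m"] sm
    by (auto simp: case_prod_unfold)
  from summable_on_Sigma_banach[OF this]
  have s2: "(\<lambda>m. of_nat (Suc m) ^ 0 * (p ^ Suc m / (1 - p ^ Suc m)\<^sup>2)) summable_on UNIV"
    unfolding col .
  show ?thesis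
    using eq sums_unique[OF has_sum_imp_sums[OF has_sum_infsum[OF s1]]]
      sums_unique[OF has_sum_imp_sums[OF has_sum_infsum[OF s2]]]
    unfolding lambert_def by simp
qed

text \<open>The generating function of the divisor sums \<sigma>(n), that is (1 - E2) / 24.\<close>
definition sigma_series :: "complex \<Rightarrow> complex" where
  "sigma_series = lambert 1 (\<lambda>y. y / (1 - y))"

lemma lambert_function_geom: "d > 0 \<Longrightarrow> lambert_function (\<lambda>y. y ^ d / (1 - y ^ d))"
    "d > 0 \<Longrightarrow> lambert_function (\<lambda>y. y ^ d / (1 - y ^ d)\<^sup>2)"
  using lambert_function_powers[of d d d 0 1] lambert_function_powers[of d d d 0 2] by auto

lemma sigma_series_eq:
  assumes "norm p < 1" "d > 0"
  shows "sigma_series (p ^ d) = lambert 1 (\<lambda>y. y ^ d / (1 - y ^ d)) p"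
    and "sigma_series (p ^ d) = lambert 0 (\<lambda>y. y ^ d / (1 - y ^ d)\<^sup>2) p"
proof -
  have "norm (p ^ d) < 1" using assms by (simp add: norm_power power_less_one_iff)
  from lambert_transpose_1[OF this]
  show "sigma_series (p ^ d) = lambert 1 (\<lambda>y. y ^ d / (1 - y ^ d)) p"
    and "sigma_series (p ^ d) = lambert 0 (\<lambda>y. y ^ d / (1 - y ^ d)\<^sup>2) p"
    by (simp_all add: sigma_series_def lambert_power)
qed

lemma divisor_fractions:
  fixes y :: complex
  assumes "norm y < 1"
  shows "y / (1 - y) = y * (1 + y + y^2 + y^3 + y^4 + y^5) / (1 - y^6)"
    and "y\<^sup>2 / (1 - y\<^sup>2) = y\<^sup>2 * (1 + y^2 + y^4) / (1 - y^6)"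
    and "y ^ 3 / (1 - y ^ 3) = y ^ 3 * (1 + y ^ 3) / (1 - y^6)"
    and "y / (1 - y)\<^sup>2 = y * (1 + y + y^2 + y^3 + y^4 + y^5)\<^sup>2 / (1 - y^6)\<^sup>2"
    and "y\<^sup>2 / (1 - y\<^sup>2)\<^sup>2 = y\<^sup>2 * (1 + y^2 + y^4)\<^sup>2 / (1 - y^6)\<^sup>2"
    and "y ^ 3 / (1 - y ^ 3)\<^sup>2 = y ^ 3 * (1 + y ^ 3)\<^sup>2 / (1 - y^6)\<^sup>2"
proof -
  have nz: "1 - y \<noteq> 0" "1 - y\<^sup>2 \<noteq> 0" "1 - y ^ 3 \<noteq> 0" "1 - y ^ 6 \<noteq> 0"
    using one_minus_power_neq_0[OF assms, of 1] one_minus_power_neq_0[OF assms, of 2]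
      one_minus_power_neq_0[OF assms, of 3] one_minus_power_neq_0[OF assms, of 6] by auto
  have f: "(1 - y) * (1 + y + y^2 + y^3 + y^4 + y^5) = 1 - y ^ 6"
    "(1 - y\<^sup>2) * (1 + y^2 + y^4) = 1 - y ^ 6" "(1 - y ^ 3) * (1 + y ^ 3) = 1 - y ^ 6"
    by (simp_all add: algebra_simps eval_nat_numeral)
  have 1: "a / u = a * v / w" "a / u\<^sup>2 = a * v\<^sup>2 / w\<^sup>2" if "u * v = w" "w \<noteq> 0" for a u v w :: complex
    using that by (auto simp flip: that(1) simp: power_mult_distrib)
  show "y / (1 - y) = y * (1 + y + y^2 + y^3 + y^4 + y^5) / (1 - y^6)"
    "y\<^sup>2 / (1 - y\<^sup>2) = y\<^sup>2 * (1 + y^2 + y^4) / (1 - y^6)"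
    "y ^ 3 / (1 - y ^ 3) = y ^ 3 * (1 + y ^ 3) / (1 - y^6)"
    "y / (1 - y)\<^sup>2 = y * (1 + y + y^2 + y^3 + y^4 + y^5)\<^sup>2 / (1 - y^6)\<^sup>2"
    "y\<^sup>2 / (1 - y\<^sup>2)\<^sup>2 = y\<^sup>2 * (1 + y^2 + y^4)\<^sup>2 / (1 - y^6)\<^sup>2"
    "y ^ 3 / (1 - y ^ 3)\<^sup>2 = y ^ 3 * (1 + y ^ 3)\<^sup>2 / (1 - y^6)\<^sup>2"
    by (intro 1 f nz)+
qed

context punctured_disc
begin

abbreviation "S1 \<equiv> sigma_series p"
abbreviation "S2 \<equiv> sigma_series (p\<^sup>2)"
abbreviation "S3 \<equiv> sigma_series (p ^ 3)"
abbreviation "S6 \<equiv> sigma_series (p ^ 6)"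

lemma sigma_series_lambert:
  "S1 = lambert 1 (\<lambda>y. y / (1 - y)) p" "S1 = lambert 0 (\<lambda>y. y / (1 - y)\<^sup>2) p"
  "S2 = lambert 1 (\<lambda>y. y\<^sup>2 / (1 - y\<^sup>2)) p" "S2 = lambert 0 (\<lambda>y. y\<^sup>2 / (1 - y\<^sup>2)\<^sup>2) p"
  "S3 = lambert 1 (\<lambda>y. y ^ 3 / (1 - y ^ 3)) p" "S3 = lambert 0 (\<lambda>y. y ^ 3 / (1 - y ^ 3)\<^sup>2) p"
  "S6 = lambert 1 (\<lambda>y. y ^ 6 / (1 - y ^ 6)) p" "S6 = lambert 0 (\<lambda>y. y ^ 6 / (1 - y ^ 6)\<^sup>2) p"
  using sigma_series_eq[OF p(2), of 1] sigma_series_eq[OF p(2), of 2]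
    sigma_series_eq[OF p(2), of 3] sigma_series_eq[OF p(2), of 6] by simp_all

lemma lambert_function_fractions:
  "lambert_function (\<lambda>y. y / (1 - y))" "lambert_function (\<lambda>y. y / (1 - y)\<^sup>2)"
  "lambert_function (\<lambda>y. y\<^sup>2 / (1 - y\<^sup>2))" "lambert_function (\<lambda>y. y\<^sup>2 / (1 - y\<^sup>2)\<^sup>2)"
  "lambert_function (\<lambda>y. y ^ 3 / (1 - y ^ 3))" "lambert_function (\<lambda>y. y ^ 3 / (1 - y ^ 3)\<^sup>2)"
  "lambert_function (\<lambda>y. y ^ 6 / (1 - y ^ 6))" "lambert_function (\<lambda>y. y ^ 6 / (1 - y ^ 6)\<^sup>2)"
  "lambert_function (geom_diff 1)" "lambert_function (geom_sum 1)" "lambert_function (sq_sum 1)" "lambert_function (sq_diff 1)"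
  "lambert_function (geom_diff 2)" "lambert_function (geom_sum 2)" "lambert_function (sq_sum 2)" "lambert_function (sq_diff 2)"
  "lambert_function (geom_diff 3)" "lambert_function (geom_sum 3)" "lambert_function (sq_sum 3)" "lambert_function (sq_diff 3)"
  using lambert_function_geom[of 1] lambert_function_geom[of 2] lambert_function_geom[of 3] lambert_function_geom[of 6]
    lambert_function_level6[of 1] lambert_function_level6[of 2] lambert_function_level6[of 3] by simp_all

text \<open>Inclusion and exclusion: s_k sums over m with m \<equiv> k or -k modulo 6, a condition on gcd m 6.
  For k = 3 the two classes coincide, which doubles the series.\<close>
lemma geom_sum_relations:
  "s1 = S1 - S2 - S3 + S6" "s2 = S2 - S6" "s3 = 2 * (S3 - S6)"
proof -
  have "s1 = lambert 1 (\<lambda>y. y / (1 - y) - y\<^sup>2 / (1 - y\<^sup>2) - y ^ 3 / (1 - y ^ 3) + y ^ 6 / (1 - y ^ 6)) p"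
  proof (rule lambert_cong[OF p])
    fix y :: complex assume y: "norm y < 1"
    show "geom_sum 1 y = y / (1 - y) - y\<^sup>2 / (1 - y\<^sup>2) - y ^ 3 / (1 - y ^ 3) + y ^ 6 / (1 - y ^ 6)"
      unfolding divisor_fractions(1-3)[OF y] geom_sum_def add_divide_distrib[symmetric] diff_divide_distrib[symmetric]
      by (rule arg_cong[where f = "\<lambda>a. a / (1 - y ^ 6)"]) (simp add: algebra_simps eval_nat_numeral)
  qed
  thus "s1 = S1 - S2 - S3 + S6"
    by (simp only: sigma_series_lambert(1,3,5,7) lambert_linearity lambert_function_fractions p)
  have "s2 = lambert 1 (\<lambda>y. y\<^sup>2 / (1 - y\<^sup>2) - y ^ 6 / (1 - y ^ 6)) p"
  proof (rule lambert_cong[OF p])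
    fix y :: complex assume y: "norm y < 1"
    show "geom_sum 2 y = y\<^sup>2 / (1 - y\<^sup>2) - y ^ 6 / (1 - y ^ 6)"
      unfolding divisor_fractions(1-3)[OF y] geom_sum_def add_divide_distrib[symmetric] diff_divide_distrib[symmetric]
      by (rule arg_cong[where f = "\<lambda>a. a / (1 - y ^ 6)"]) (simp add: algebra_simps eval_nat_numeral)
  qed
  thus "s2 = S2 - S6"
    by (simp only: sigma_series_lambert(1,3,5,7) lambert_linearity lambert_function_fractions p)
  have "s3 = lambert 1 (\<lambda>y. 2 * (y ^ 3 / (1 - y ^ 3) - y ^ 6 / (1 - y ^ 6))) p"
  proof (rule lambert_cong[OF p])
    fix y :: complex assume y: "norm y < 1"
    show "geom_sum 3 y = 2 * (y ^ 3 / (1 - y ^ 3) - y ^ 6 / (1 - y ^ 6))"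
      unfolding divisor_fractions(1-3)[OF y] geom_sum_def add_divide_distrib[symmetric] diff_divide_distrib[symmetric] times_divide_eq_right
      by (rule arg_cong[where f = "\<lambda>a. a / (1 - y ^ 6)"]) (simp add: algebra_simps eval_nat_numeral)
  qed
  thus "s3 = 2 * (S3 - S6)"
    by (simp only: sigma_series_lambert(1,3,5,7) lambert_linearity lambert_function_fractions p)
qed

text \<open>The m-series express the sums \<Sum> m p^(n m) over m in a class modulo 6 up to a multiple of the
  corresponding r-series, because m = 6 j + k.\<close>
lemma sq_sum_relations:
  "6 * m1 + r1 = S1 - 2 * S2 - 3 * S3 + 6 * S6" "3 * m2 + r2 = S2 - 3 * S6" "m3 = S3 - 2 * S6"
proof -
  have gd: "geom_diff k y = (y ^ k - y ^ (6 - k)) * (1 - y ^ 6) / (1 - y ^ 6)\<^sup>2" if "norm y < 1" for k and y :: complex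
    using one_minus_power_neq_0[OF that, of 6] by (simp add: geom_diff_def power2_eq_square)
  have "lambert 0 (\<lambda>y. 6 * sq_sum 1 y + geom_diff 1 y) p =
     lambert 0 (\<lambda>y. y / (1 - y)\<^sup>2 - 2 * (y\<^sup>2 / (1 - y\<^sup>2)\<^sup>2) - 3 * (y ^ 3 / (1 - y ^ 3)\<^sup>2) + 6 * (y ^ 6 / (1 - y ^ 6)\<^sup>2)) p"
  proof (rule lambert_cong[OF p])
    fix y :: complex assume y: "norm y < 1"
    show "6 * sq_sum 1 y + geom_diff 1 y =
       y / (1 - y)\<^sup>2 - 2 * (y\<^sup>2 / (1 - y\<^sup>2)\<^sup>2) - 3 * (y ^ 3 / (1 - y ^ 3)\<^sup>2) + 6 * (y ^ 6 / (1 - y ^ 6)\<^sup>2)"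
      unfolding divisor_fractions(4-6)[OF y] sq_sum_def gd[OF y] times_divide_eq_right
        add_divide_distrib[symmetric] diff_divide_distrib[symmetric]
      by (rule arg_cong[where f = "\<lambda>a. a / (1 - y ^ 6)\<^sup>2"]) (simp add: algebra_simps eval_nat_numeral)
  qed
  thus "6 * m1 + r1 = S1 - 2 * S2 - 3 * S3 + 6 * S6"
    by (simp only: sigma_series_lambert(2,4,6,8) lambert_linearity lambert_function_fractions p)
  have "lambert 0 (\<lambda>y. 3 * sq_sum 2 y + geom_diff 2 y) p =
     lambert 0 (\<lambda>y. (y\<^sup>2 / (1 - y\<^sup>2)\<^sup>2) - 3 * (y ^ 6 / (1 - y ^ 6)\<^sup>2)) p"
  proof (rule lambert_cong[OF p])
    fix y :: complex assume y: "norm y < 1"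
    show "3 * sq_sum 2 y + geom_diff 2 y = (y\<^sup>2 / (1 - y\<^sup>2)\<^sup>2) - 3 * (y ^ 6 / (1 - y ^ 6)\<^sup>2)"
      unfolding divisor_fractions(4-6)[OF y] sq_sum_def gd[OF y] times_divide_eq_right
        add_divide_distrib[symmetric] diff_divide_distrib[symmetric]
      by (rule arg_cong[where f = "\<lambda>a. a / (1 - y ^ 6)\<^sup>2"]) (simp add: algebra_simps eval_nat_numeral)
  qed
  thus "3 * m2 + r2 = S2 - 3 * S6"
    by (simp only: sigma_series_lambert(2,4,6,8) lambert_linearity lambert_function_fractions p)
  have "m3 = lambert 0 (\<lambda>y. y ^ 3 / (1 - y ^ 3)\<^sup>2 - 2 * (y ^ 6 / (1 - y ^ 6)\<^sup>2)) p"
  proof (rule lambert_cong[OF p])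
    fix y :: complex assume y: "norm y < 1"
    show "sq_sum 3 y = y ^ 3 / (1 - y ^ 3)\<^sup>2 - 2 * (y ^ 6 / (1 - y ^ 6)\<^sup>2)"
      unfolding divisor_fractions(4-6)[OF y] sq_sum_def gd[OF y] times_divide_eq_right
        add_divide_distrib[symmetric] diff_divide_distrib[symmetric]
      by (rule arg_cong[where f = "\<lambda>a. a / (1 - y ^ 6)\<^sup>2"]) (simp add: algebra_simps eval_nat_numeral)
  qed
  thus "m3 = S3 - 2 * S6"
    by (simp only: sigma_series_lambert(2,4,6,8) lambert_linearity lambert_function_fractions p)
qed

text \<open>The series S1, S2, S3, S6 satisfy the three equations of sq_sum_relations; s3 serves as the
  remaining free parameter.\<close>
lemma sigma_series_polynomials:
  "S1 = 3 * s3 - 5/2 * r2 + 9/2 * r2\<^sup>2 + r1 - 12 * r1 * r2 + 9/2 * r1\<^sup>2"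
  "S2 = 3/2 * s3 - 1/2 * r2 + 9/2 * r2\<^sup>2 - 6 * r1 * r2 + 3/2 * r1\<^sup>2"
  "S3 = s3 - 1/2 * r2 + 1/2 * r2\<^sup>2 - 2 * r1 * r2 + 1/2 * r1\<^sup>2"
  "S6 = 1/2 * s3 - 1/2 * r2 + 1/2 * r2\<^sup>2 - 2 * r1 * r2 + 1/2 * r1\<^sup>2"
proof -
  have m1: "m1 = (r1\<^sup>2 - 2 * r1 * r2 - r2 - r2\<^sup>2) / 2" and m3: "m3 = r1 * r2 - m1 - m2"
    using weight2_relations by (auto simp: field_simps)
  have "s3 = 2 * m3 + 2 * S6"
    unfolding geom_sum_relations(3) sq_sum_relations(3) by (simp add: algebra_simps)
  hence e6: "S6 = 1/2 * s3 - m3" by (simp add: field_simps)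
  have e3: "S3 = m3 + 2 * S6" using sq_sum_relations(3) by simp
  have e2: "S2 = 3 * m2 + r2 + 3 * S6" using sq_sum_relations(2) by simp
  have e1: "S1 = 6 * m1 + r1 + 2 * S2 + 3 * S3 - 6 * S6" using sq_sum_relations(1) by simp
  note subst = m3 m1 weight2_relations(1)
  show "S6 = 1/2 * s3 - 1/2 * r2 + 1/2 * r2\<^sup>2 - 2 * r1 * r2 + 1/2 * r1\<^sup>2"
    unfolding e6 subst by (simp add: field_simps)
  show "S3 = s3 - 1/2 * r2 + 1/2 * r2\<^sup>2 - 2 * r1 * r2 + 1/2 * r1\<^sup>2"
    unfolding e3 e6 subst by (simp add: field_simps)
  show "S2 = 3/2 * s3 - 1/2 * r2 + 9/2 * r2\<^sup>2 - 6 * r1 * r2 + 3/2 * r1\<^sup>2"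
    unfolding e2 e6 subst by (simp add: field_simps)
  show "S1 = 3 * s3 - 5/2 * r2 + 9/2 * r2\<^sup>2 + r1 - 12 * r1 * r2 + 9/2 * r1\<^sup>2"
    unfolding e1 e2 e3 e6 subst by (simp add: field_simps)
qed

text \<open>Total derivatives along x = p^k, q = p^6: besides k x d/dx there is 6 q d/dq, which acts on
  1 / (1 - q^n) and produces the squared denominators.\<close>
lemma euler_derivs:
  "p * deriv (lambert 0 (geom_diff 1)) p = s1 - 6 * lambert 1 (sq_diff 1) p"
  "p * deriv (lambert 0 (geom_diff 2)) p = 2 * s2 - 6 * lambert 1 (sq_diff 2) p"
  "p * deriv (lambert 1 (geom_sum 3)) p = 6 * lambert 2 (sq_sum 3) p"
proof -
  have quot: "y * deriv (\<lambda>y. N y / (1 - y ^ 6)) y = (y * N' * (1 - y ^ 6) + 6 * y ^ 6 * N y) / (1 - y ^ 6)\<^sup>2"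
    if "(N has_field_derivative N') (at y)" "norm y < 1" for y N' :: complex and N
  proof -
    have nz: "1 - y ^ 6 \<noteq> 0" using one_minus_power_neq_0[OF that(2), of 6] by simp
    have "((\<lambda>y. N y / (1 - y ^ 6)) has_field_derivative ((N' * (1 - y ^ 6) + 6 * y ^ 5 * N y) / (1 - y ^ 6)\<^sup>2)) (at y)"
      using nz by (auto intro!: derivative_eq_intros that(1) simp: power2_eq_square)
    thus ?thesis by (simp add: DERIV_imp_deriv algebra_simps eval_nat_numeral)
  qed
  have "p * deriv (lambert 0 (geom_diff 1)) p = lambert 1 (\<lambda>y. y * deriv (geom_diff 1) y) p"
    using lambert_function.euler_deriv_lambert[OF lambert_function_fractions(9) p(2), of 0] by simp
  also have "\<dots> = lambert 1 (\<lambda>y. geom_sum 1 y - 6 * sq_diff 1 y) p"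
  proof (rule lambert_cong[OF p])
    fix y :: complex assume y: "norm y < 1"
    have nz: "1 - y ^ 6 \<noteq> 0" using one_minus_power_neq_0[OF y, of 6] by simp
    have gs: "geom_sum 1 y = (y + y ^ 5) * (1 - y ^ 6) / (1 - y ^ 6)\<^sup>2"
      using nz by (simp add: geom_sum_def power2_eq_square)
    have "((\<lambda>y. y - y ^ 5) has_field_derivative 1 - 5 * y ^ 4) (at y)"
      by (auto intro!: derivative_eq_intros)
    from quot[OF this y] show "y * deriv (geom_diff 1) y = geom_sum 1 y - 6 * sq_diff 1 y"
      unfolding gs by (simp add: geom_diff_def[abs_def] sq_diff_def diff_divide_distrib[symmetric])
        (simp add: algebra_simps eval_nat_numeral)
  qed
  finally show "p * deriv (lambert 0 (geom_diff 1)) p = s1 - 6 * lambert 1 (sq_diff 1) p"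
    by (simp only: lambert_linearity lambert_function_fractions p)
  have "p * deriv (lambert 0 (geom_diff 2)) p = lambert 1 (\<lambda>y. y * deriv (geom_diff 2) y) p"
    using lambert_function.euler_deriv_lambert[OF lambert_function_fractions(13) p(2), of 0] by simp
  also have "\<dots> = lambert 1 (\<lambda>y. 2 * geom_sum 2 y - 6 * sq_diff 2 y) p"
  proof (rule lambert_cong[OF p])
    fix y :: complex assume y: "norm y < 1"
    have nz: "1 - y ^ 6 \<noteq> 0" using one_minus_power_neq_0[OF y, of 6] by simp
    have gs: "geom_sum 2 y = (y\<^sup>2 + y ^ 4) * (1 - y ^ 6) / (1 - y ^ 6)\<^sup>2"
      using nz by (simp add: geom_sum_def power2_eq_square)
    have "((\<lambda>y. y\<^sup>2 - y ^ 4) has_field_derivative 2 * y - 4 * y ^ 3) (at y)"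
      by (auto intro!: derivative_eq_intros)
    from quot[OF this y] show "y * deriv (geom_diff 2) y = 2 * geom_sum 2 y - 6 * sq_diff 2 y"
      unfolding gs by (simp add: geom_diff_def[abs_def] sq_diff_def diff_divide_distrib[symmetric])
        (simp add: algebra_simps eval_nat_numeral)
  qed
  finally show "p * deriv (lambert 0 (geom_diff 2)) p = 2 * s2 - 6 * lambert 1 (sq_diff 2) p"
    by (simp only: lambert_linearity lambert_function_fractions p)
  have "p * deriv (lambert 1 (geom_sum 3)) p = lambert 2 (\<lambda>y. y * deriv (geom_sum 3) y) p"
    using lambert_function.euler_deriv_lambert[OF lambert_function_fractions(18) p(2), of 1] by (simp add: numeral_2_eq_2)
  also have "\<dots> = lambert 2 (\<lambda>y. 6 * sq_sum 3 y) p"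
  proof (rule lambert_cong[OF p])
    fix y :: complex assume y: "norm y < 1"
    have "((\<lambda>y. y ^ 3 + y ^ 3) has_field_derivative 6 * y\<^sup>2) (at y)"
      by (auto intro!: derivative_eq_intros)
    from quot[OF this y] show "y * deriv (geom_sum 3) y = 6 * sq_sum 3 y"
      by (simp add: geom_sum_def[abs_def] sq_sum_def)
        (simp add: algebra_simps eval_nat_numeral)
  qed
  finally show "p * deriv (lambert 1 (geom_sum 3)) p = 6 * lambert 2 (sq_sum 3) p"
    by (simp only: lambert_linearity lambert_function_fractions p)
qed

end

text \<open>Obtained from weight3_relations and weight4_relation on writing s1 and s2 as polynomials in
  a = r1, b = r2 and c = s3.\<close>
definition ode_a where "ode_a a b c = (-2*c - 2*b - 12*b^2 + a - 6*a*c - 36*a*b^2 + 3*a^2 + 18*a^2*b :: complex)"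
definition ode_b where "ode_b a b c = (-c - 6*b*c + 8*b^2 - 8*a*b + 24*a*b^2 + 2*a^2 - 24*a^2*b + 6*a^3 :: complex)"
definition ode_c where "ode_c a b c = (-6*c^2 - 48*b^3 + 72*a*b^2 - 144*a*b^3 - 36*a^2*b + 216*a^2*b^2 + 6*a^3 - 108*a^3*b + 18*a^4 :: complex)"

lemma (in punctured_disc) lambert_ode:
  "p * deriv (lambert 0 (geom_diff 1)) p = ode_a r1 r2 s3"
  "p * deriv (lambert 0 (geom_diff 2)) p = ode_b r1 r2 s3"
  "p * deriv (lambert 1 (geom_sum 3)) p = ode_c r1 r2 s3"
proof -
  have s1: "s1 = s3 - 2*r2 + r1 - 6*r1*r2 + 3*r1\<^sup>2" and s2: "s2 = s3 + 4*r2\<^sup>2 - 4*r1*r2 + r1\<^sup>2"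
    unfolding geom_sum_relations(1,2) sigma_series_polynomials by (simp_all add: field_simps)
  show "p * deriv (lambert 0 (geom_diff 1)) p = ode_a r1 r2 s3"
    unfolding euler_derivs weight3_relations s1 ode_a_def by (simp add: field_simps power2_eq_square)
  show "p * deriv (lambert 0 (geom_diff 2)) p = ode_b r1 r2 s3"
    unfolding euler_derivs weight3_relations s2 ode_b_def by (simp add: field_simps eval_nat_numeral)
  show "p * deriv (lambert 1 (geom_sum 3)) p = ode_c r1 r2 s3"
    unfolding euler_derivs weight4_relation s1 s2 ode_c_def by (simp add: field_simps eval_nat_numeral)
qed

section \<open>Eta quotients as linear forms\<close>

definition euler_prod :: "complex \<Rightarrow> complex" where
  "euler_prod p = (\<Prod>n. 1 - p ^ Suc n)"

lemma euler_prod_convergent: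
  fixes p :: complex
  assumes "norm p < 1"
  shows "convergent_prod (\<lambda>n. 1 - p ^ Suc n)"
proof -
  have "convergent_prod (\<lambda>n. 1 + - (p ^ Suc n))"
  proof (rule summable_imp_convergent_prod_complex)
    show "summable (\<lambda>n. norm (- (p ^ Suc n)))"
      using assms by (simp add: norm_mult norm_power summable_mult summable_geometric)
    show "- (p ^ Suc n) \<noteq> - 1" for n
      using one_minus_power_neq_0[OF assms, of "Suc n"] by auto
  qed
  thus ?thesis by simp
qed

lemma euler_prod_nonzero: "norm p < 1 \<Longrightarrow> euler_prod p \<noteq> 0"
  unfolding euler_prod_def
  using euler_prod_convergent one_minus_power_neq_0[of p]
  by (intro prodinf_nonzero) (auto simp del: power_Suc)

lemma euler_prod_0 [simp]: "euler_prod 0 = 1"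
  by (simp add: euler_prod_def)

text \<open>Uniform convergence on discs is what allows logarithmic differentiation of the product.\<close>
lemma euler_prod_uniform_limit:
  assumes "0 \<le> r" "r < 1"
  shows "uniform_limit (cball 0 r) (\<lambda>N p. \<Prod>n<N. 1 - p ^ Suc n) euler_prod sequentially"
proof -
  have "uniformly_convergent_on (cball 0 r) (\<lambda>N p. \<Prod>n<N. (1 - p ^ Suc n :: complex))"
  proof (rule uniformly_convergent_on_prod')
    have "uniformly_convergent_on (cball 0 r) (\<lambda>N p. \<Sum>n<N. norm (p ^ Suc n :: complex))"
    proof (rule Weierstrass_m_test'[where M = "\<lambda>n. r ^ Suc n"])
      fix n and x :: complex assume "x \<in> cball 0 r"
      thus "norm (norm (x ^ Suc n)) \<le> r ^ Suc n"
        unfolding norm_power by (auto simp del: power_Suc simp: norm_power intro!: power_mono)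
    next
      show "summable (\<lambda>n. r ^ Suc n)"
        using assms by (simp add: summable_mult summable_geometric)
    qed
    thus "uniformly_convergent_on (cball 0 r) (\<lambda>N p. \<Sum>n<N. norm (1 - p ^ Suc n - 1 :: complex))"
      by (simp del: power_Suc)
  qed (auto intro!: continuous_intros)
  then obtain l where l: "uniform_limit (cball 0 r) (\<lambda>N p. \<Prod>n<N. (1 - p ^ Suc n :: complex)) l sequentially"
    by (auto simp: uniformly_convergent_on_def)
  have "l p = euler_prod p" if "p \<in> cball 0 r" for p
  proof -
    have "norm p < 1" using that assms by auto
    hence "(\<lambda>N. \<Prod>n\<le>N. 1 - p ^ Suc n) \<longlonglongrightarrow> euler_prod p"
      unfolding euler_prod_def by (intro convergent_prod_LIMSEQ euler_prod_convergent)
    hence "(\<lambda>N. \<Prod>n<N. 1 - p ^ Suc n) \<longlonglongrightarrow> euler_prod p"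
      by (subst LIMSEQ_lessThan_iff_atMost)
    thus ?thesis
      using tendsto_uniform_limitI[OF l that] LIMSEQ_unique by blast
  qed
  thus ?thesis using l by (subst (asm) uniform_limit_cong') auto
qed

lemma euler_prod_deriv:
  assumes "norm p < 1"
  shows "euler_prod field_differentiable (at p)"
    and "p * deriv euler_prod p = - sigma_series p * euler_prod p"
proof -
  define r where "r = (norm p + 1) / 2"
  have r: "0 \<le> r" "r < 1" "norm p < r" using assms by (auto simp: r_def)
  have p: "p \<in> ball 0 r" using r by simp
  have ul: "uniform_limit (ball 0 r) (\<lambda>N p. \<Prod>n<N. 1 - p ^ Suc n) euler_prod sequentially"
    by (rule uniform_limit_on_subset[OF euler_prod_uniform_limit[OF r(1,2)] ball_subset_cball])
  have "euler_prod holomorphic_on ball 0 r"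
  proof (rule holomorphic_uniform_sequence[OF open_ball])
    fix n show "(\<lambda>p. \<Prod>n<n. 1 - p ^ Suc n) holomorphic_on ball 0 r"
      by (intro holomorphic_intros)
  next
    fix x assume "x \<in> ball (0::complex) r"
    then obtain d where "d > 0" "cball x d \<subseteq> ball 0 r"
      using open_contains_cball[of "ball (0::complex) r"] open_ball by blast
    thus "\<exists>d>0. cball x d \<subseteq> ball 0 r \<and> uniform_limit (cball x d) (\<lambda>n p. \<Prod>n<n. 1 - p ^ Suc n) euler_prod sequentially"
      using uniform_limit_on_subset[OF ul] by blast
  qed
  thus "euler_prod field_differentiable (at p)"
    using p open_ball holomorphic_on_imp_differentiable_at by blast
  have "(\<lambda>n. deriv (\<lambda>p. 1 - p ^ Suc n) p / (1 - p ^ Suc n)) sums (deriv euler_prod p / euler_prod p)"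
    by (rule logderiv_prodinf_complex_uniform_limit[OF ul _ euler_prod_nonzero[OF assms] open_ball p])
       (intro holomorphic_intros)
  hence "(\<lambda>n. - p * (deriv (\<lambda>p. 1 - p ^ Suc n) p / (1 - p ^ Suc n))) sums (- p * (deriv euler_prod p / euler_prod p))"
    by (rule sums_mult)
  also have "(\<lambda>n. deriv (\<lambda>p. 1 - p ^ Suc n) p) = (\<lambda>n. - (of_nat (Suc n) * p ^ n))"
    by (intro ext DERIV_imp_deriv) (auto intro!: derivative_eq_intros simp del: power_Suc of_nat_Suc)
  hence "(\<lambda>n. - p * (deriv (\<lambda>p. 1 - p ^ Suc n) p / (1 - p ^ Suc n))) =
      (\<lambda>n. - p * (- (of_nat (Suc n) * p ^ n) / (1 - p ^ Suc n)))"
    by (simp only: fun_eq_iff) simp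
  also have "(\<lambda>n. - p * (- (of_nat (Suc n) * p ^ n) / (1 - p ^ Suc n))) = (\<lambda>n. of_nat (Suc n) ^ 1 * (p ^ Suc n / (1 - p ^ Suc n)))"
    by (auto simp: mult_ac)
  finally have "sigma_series p = - p * (deriv euler_prod p / euler_prod p)"
    unfolding sigma_series_def lambert_def by (simp only: sums_unique[symmetric])
  thus "p * deriv euler_prod p = - sigma_series p * euler_prod p"
    using euler_prod_nonzero[OF assms] by (simp add: field_simps)
qed

text \<open>The equation is not divided by v p, so that the notion also applies where the nonvanishing of v
  is yet to be proved.\<close>
definition has_log_deriv :: "(complex \<Rightarrow> complex) \<Rightarrow> complex \<Rightarrow> complex \<Rightarrow> bool" where
  "has_log_deriv v w p \<longleftrightarrow> (\<exists>v'. (v has_field_derivative v') (at p) \<and> p * v' = w * v p)"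

lemma has_log_deriv_mult:
  assumes "has_log_deriv u a p" "has_log_deriv v b p"
  shows "has_log_deriv (\<lambda>p. u p * v p) (a + b) p"
proof -
  from assms obtain u' v' where d: "(u has_field_derivative u') (at p)" "(v has_field_derivative v') (at p)"
    and e: "p * u' = a * u p" "p * v' = b * v p" by (auto simp: has_log_deriv_def)
  have "p * (u' * v p + v' * u p) = (p * u') * v p + (p * v') * u p" by (simp add: algebra_simps)
  also have "\<dots> = (a + b) * (u p * v p)" unfolding e by (simp add: algebra_simps)
  finally show ?thesis
    unfolding has_log_deriv_def using DERIV_mult[OF d] by blast
qed

lemma has_log_deriv_inverse:
  assumes "has_log_deriv v b p" "v p \<noteq> 0"
  shows "has_log_deriv (\<lambda>p. inverse (v p)) (- b) p"
proof -
  from assms obtain v' where d: "(v has_field_derivative v') (at p)"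
    and e: "p * v' = b * v p" by (auto simp: has_log_deriv_def)
  have "p * (- (inverse (v p) * v' * inverse (v p))) = - (p * v') * (inverse (v p) * inverse (v p))"
    by (simp add: algebra_simps)
  also have "\<dots> = - b * inverse (v p)"
    unfolding e using assms(2) by simp
  finally show ?thesis
    unfolding has_log_deriv_def using DERIV_inverse'[OF d assms(2)] by blast
qed

lemma has_log_deriv_divide:
  assumes "has_log_deriv u a p" "has_log_deriv v b p" "v p \<noteq> 0"
  shows "has_log_deriv (\<lambda>p. u p / v p) (a - b) p"
  using has_log_deriv_mult[OF assms(1) has_log_deriv_inverse[OF assms(2,3)]] by (simp add: divide_inverse)

lemma has_log_deriv_power:
  assumes "has_log_deriv u a p"
  shows "has_log_deriv (\<lambda>p. u p ^ n) (of_nat n * a) p"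
proof (induction n)
  case 0 show ?case by (auto simp: has_log_deriv_def intro!: exI[of _ 0])
next
  case (Suc n)
  show ?case using has_log_deriv_mult[OF assms Suc] by (simp add: algebra_simps)
qed

lemma has_log_deriv_ident: "has_log_deriv (\<lambda>p. p) 1 p"
  by (auto simp: has_log_deriv_def intro!: exI[of _ 1])

lemma has_log_deriv_euler_prod:
  assumes "norm p < 1" "d > 0"
  shows "has_log_deriv (\<lambda>p. euler_prod (p ^ d)) (- of_nat d * sigma_series (p ^ d)) p"
proof -
  have pd: "norm (p ^ d) < 1" using assms by (simp add: norm_power power_less_one_iff)
  have "((\<lambda>p. euler_prod (p ^ d)) has_field_derivative deriv euler_prod (p ^ d) * (of_nat d * p ^ (d - 1))) (at p)"
    by (rule DERIV_chain'[where g = euler_prod and f = "\<lambda>p. p ^ d", rotated, OF field_differentiable_derivI[OF euler_prod_deriv(1)[OF pd]]])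
       (auto intro!: derivative_eq_intros)
  moreover have "p * (deriv euler_prod (p ^ d) * (of_nat d * p ^ (d - 1))) = of_nat d * (p ^ d * deriv euler_prod (p ^ d))"
    using assms(2) by (cases d) auto
  ultimately show ?thesis
    unfolding has_log_deriv_def euler_prod_deriv(2)[OF pd] by (auto simp: algebra_simps)
qed

text \<open>The quotient u / v has derivative zero on the punctured disc, which is connected, and its
  constant value is read off at 0.  Nonvanishing of v carries over to u.\<close>
lemma log_deriv_unique:
  assumes u: "\<And>p. 0 < norm p \<Longrightarrow> norm p < 1 \<Longrightarrow> has_log_deriv u (w p) p"
    and v: "\<And>p. 0 < norm p \<Longrightarrow> norm p < 1 \<Longrightarrow> has_log_deriv v (w p) p"
    and nz: "\<And>p. 0 < norm p \<Longrightarrow> norm p < 1 \<Longrightarrow> v p \<noteq> 0"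
    and lim: "((\<lambda>p. u p / v p) \<longlongrightarrow> 1) (at 0)"
    and p: "0 < norm p" "norm p < 1"
  shows "u p = v p"
proof -
  let ?X = "ball (0::complex) 1 - {0}"
  have "(\<lambda>p. u p / v p) constant_on ?X"
  proof (rule has_field_derivative_0_imp_constant_on)
    fix z assume z: "z \<in> ?X"
    hence "has_log_deriv (\<lambda>p. u p / v p) (w z - w z) z"
      by (intro has_log_deriv_divide u v nz) auto
    thus "((\<lambda>p. u p / v p) has_field_derivative 0) (at z)"
      using z by (auto simp: has_log_deriv_def)
  qed (auto intro!: connected_open_delete)
  then obtain c where c: "\<And>z. z \<in> ?X \<Longrightarrow> u z / v z = c"
    by (auto simp: constant_on_def)
  have "eventually (\<lambda>z. z \<in> ?X) (at (0::complex))"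
    by (intro eventually_at_in_open) auto
  hence "eventually (\<lambda>z. u z / v z = c) (at 0)"
    by eventually_elim (rule c)
  hence "((\<lambda>p. u p / v p) \<longlongrightarrow> c) (at 0)"
    by (rule tendsto_eventually)
  hence "c = 1" using lim by (rule tendsto_unique[OF at_neq_bot])
  thus ?thesis using c[of p] nz[OF p] p by (auto simp: field_simps)
qed

lemma euler_prod_power_tendsto:
  assumes "d > 0"
  shows "((\<lambda>p. euler_prod (p ^ d)) \<longlongrightarrow> 1) (at 0)"
proof -
  have "isCont euler_prod 0"
    using euler_prod_deriv(1)[of 0] by (simp add: field_differentiable_imp_continuous_at)
  moreover have "((\<lambda>p::complex. p ^ d) \<longlongrightarrow> 0 ^ d) (at 0)"
    by (intro tendsto_intros)
  ultimately show ?thesis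
    using isCont_tendsto_compose[of 0 euler_prod "\<lambda>p. p ^ d"] assms by (simp add: zero_power)
qed

definition eis_a where "eis_a = lambert 0 (geom_diff 1)"
definition eis_b where "eis_b = lambert 0 (geom_diff 2)"
definition eis_c where "eis_c = lambert 1 (geom_sum 3)"

lemma eis_has_deriv:
  assumes "norm p < 1"
  shows "(eis_a has_field_derivative deriv eis_a p) (at p)" "(eis_b has_field_derivative deriv eis_b p) (at p)"
    "(eis_c has_field_derivative deriv eis_c p) (at p)"
  using assms lambert_function_level6[of 1] lambert_function_level6[of 2] lambert_function_level6[of 3]
  by (auto simp: eis_a_def eis_b_def eis_c_def intro!: lambert_function.lambert_has_deriv)

lemma eis_ode:
  assumes "0 < norm p" "norm p < 1"
  shows "p * deriv eis_a p = ode_a (eis_a p) (eis_b p) (eis_c p)" "p * deriv eis_b p = ode_b (eis_a p) (eis_b p) (eis_c p)"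
    "p * deriv eis_c p = ode_c (eis_a p) (eis_b p) (eis_c p)"
  using punctured_disc.lambert_ode[of p] assms unfolding eis_a_def eis_b_def eis_c_def punctured_disc_def by auto

lemma sigma_series_eis:
  assumes "0 < norm p" "norm p < 1"
  shows "sigma_series p = 3 * eis_c p - 5/2 * eis_b p + 9/2 * (eis_b p)\<^sup>2 + eis_a p - 12 * eis_a p * eis_b p + 9/2 * (eis_a p)\<^sup>2"
  "sigma_series (p\<^sup>2) = 3/2 * eis_c p - 1/2 * eis_b p + 9/2 * (eis_b p)\<^sup>2 - 6 * eis_a p * eis_b p + 3/2 * (eis_a p)\<^sup>2"
  "sigma_series (p ^ 3) = eis_c p - 1/2 * eis_b p + 1/2 * (eis_b p)\<^sup>2 - 2 * eis_a p * eis_b p + 1/2 * (eis_a p)\<^sup>2"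
  "sigma_series (p ^ 6) = 1/2 * eis_c p - 1/2 * eis_b p + 1/2 * (eis_b p)\<^sup>2 - 2 * eis_a p * eis_b p + 1/2 * (eis_a p)\<^sup>2"
  using punctured_disc.sigma_series_polynomials[of p] assms unfolding eis_a_def eis_b_def eis_c_def punctured_disc_def by auto

lemma eis_tendsto_0: "(eis_a \<longlongrightarrow> 0) (at 0)" "(eis_b \<longlongrightarrow> 0) (at 0)"
  unfolding eis_a_def eis_b_def using lambert_function_level6[of 1] lambert_function_level6[of 2]
  by (auto intro!: lambert_function.lambert_tendsto_0)

lemma eis_at_0: "deriv eis_a 0 = 1" "deriv eis_b 0 = 0" "eis_a 0 = 0" "eis_b 0 = 0"
proof -
  have "(geom_diff 1 has_field_derivative 1) (at 0)" "(geom_diff 2 has_field_derivative 0) (at 0)"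
    unfolding geom_diff_def by (auto intro!: derivative_eq_intros)
  thus "deriv eis_a 0 = 1" "deriv eis_b 0 = 0"
    using lambert_function.deriv_lambert_0[OF lambert_function_level6(1)[of 1], of 0]
      lambert_function.deriv_lambert_0[OF lambert_function_level6(1)[of 2], of 0]
    by (auto simp: eis_a_def eis_b_def DERIV_imp_deriv)
  show "eis_a 0 = 0" "eis_b 0 = 0"
    by (simp_all add: eis_a_def eis_b_def lambert_at_0 geom_diff_def)
qed

lemma linear_form_log_deriv:
  assumes p: "norm p < 1" and "p * (b * deriv eis_a p + c * deriv eis_b p) = w * (a + b * eis_a p + c * eis_b p)"
  shows "has_log_deriv (\<lambda>p. a + b * eis_a p + c * eis_b p) w p"
  unfolding has_log_deriv_def
  by (intro exI[of _ "b * deriv eis_a p + c * deriv eis_b p"] conjI assms)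
     (auto intro!: derivative_eq_intros eis_has_deriv[OF p])

text \<open>The four eta quotients of weight one with all zeros at a single cusp.  The linear forms are
  combinations of the modular forms eis_a + 1/3 and eis_b + 1/6, which explains their constant terms.
  All coefficients are displayed, including 0 and 1, to match linear_form_log_deriv.  The last form
  vanishes to first order at p = 0, so there the comparison of leading coefficients uses the
  derivative at 0.\<close>
lemma eta_quotients:
  assumes p: "0 < norm p" "norm p < 1"
  shows "1 + 3 * eis_a p + 0 * eis_b p =
      euler_prod (p ^ 2) ^ 6 * euler_prod (p ^ 3) / (euler_prod (p ^ 1) ^ 3 * euler_prod (p ^ 6) ^ 2)"
    and "1 + 2 * eis_a p + 2 * eis_b p =
      euler_prod (p ^ 2) * euler_prod (p ^ 3) ^ 6 / (euler_prod (p ^ 1) ^ 2 * euler_prod (p ^ 6) ^ 3)"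
    and "1 + (- 6) * eis_a p + 18 * eis_b p =
      euler_prod (p ^ 1) ^ 6 * euler_prod (p ^ 6) / (euler_prod (p ^ 2) ^ 3 * euler_prod (p ^ 3) ^ 2)"
    and "0 + 1 * eis_a p + (- 2) * eis_b p =
      p * (euler_prod (p ^ 1) * euler_prod (p ^ 6) ^ 6 / (euler_prod (p ^ 2) ^ 2 * euler_prod (p ^ 3) ^ 3))"
proof -
  have nz: "euler_prod (p ^ d) \<noteq> 0" if "norm p < 1" "d > 0" for p d
    using that by (intro euler_prod_nonzero) (simp add: norm_power power_less_one_iff)
  have lim0: "((\<lambda>p. 1 + b * eis_a p + c * eis_b p) \<longlongrightarrow> 1) (at 0)" for b c
    by (rule tendsto_eq_intros eis_tendsto_0 refl | simp)+
  note ld = has_log_deriv_mult has_log_deriv_divide has_log_deriv_power has_log_deriv_euler_prod has_log_deriv_ident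
  note alg = eis_ode sigma_series_eis ode_a_def ode_b_def
  show "1 + 3 * eis_a p + 0 * eis_b p =
      euler_prod (p ^ 2) ^ 6 * euler_prod (p ^ 3) / (euler_prod (p ^ 1) ^ 3 * euler_prod (p ^ 6) ^ 2)"
  proof (rule log_deriv_unique[OF _ _ _ _ p])
    fix p :: complex assume p: "0 < norm p" "norm p < 1"
    show "has_log_deriv (\<lambda>p. euler_prod (p ^ 2) ^ 6 * euler_prod (p ^ 3) / (euler_prod (p ^ 1) ^ 3 * euler_prod (p ^ 6) ^ 2))
      ((of_nat 6 * (- of_nat 2 * sigma_series (p ^ 2)) + (- of_nat 3 * sigma_series (p ^ 3))) -
       (of_nat 3 * (- of_nat 1 * sigma_series (p ^ 1)) + of_nat 2 * (- of_nat 6 * sigma_series (p ^ 6)))) p"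
      by (intro ld p) (use nz[OF p(2)] nz[OF p(2), of 1] in auto)
    show "has_log_deriv (\<lambda>p. 1 + 3 * eis_a p + 0 * eis_b p)
      ((of_nat 6 * (- of_nat 2 * sigma_series (p ^ 2)) + (- of_nat 3 * sigma_series (p ^ 3))) -
       (of_nat 3 * (- of_nat 1 * sigma_series (p ^ 1)) + of_nat 2 * (- of_nat 6 * sigma_series (p ^ 6)))) p"
      by (rule linear_form_log_deriv[OF p(2)])
         (use p in \<open>simp add: distrib_left mult.left_commute[of p] alg; simp add: field_simps eval_nat_numeral\<close>)
    show "euler_prod (p ^ 2) ^ 6 * euler_prod (p ^ 3) / (euler_prod (p ^ 1) ^ 3 * euler_prod (p ^ 6) ^ 2) \<noteq> 0"
      using nz[OF p(2)] nz[OF p(2), of 1] by simp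
  next
    show "((\<lambda>p. (1 + 3 * eis_a p + 0 * eis_b p) / (euler_prod (p ^ 2) ^ 6 * euler_prod (p ^ 3) / (euler_prod (p ^ 1) ^ 3 * euler_prod (p ^ 6) ^ 2))) \<longlongrightarrow> 1) (at 0)"
      by (rule tendsto_eq_intros lim0 euler_prod_power_tendsto refl | simp)+
  qed
  show "1 + 2 * eis_a p + 2 * eis_b p =
      euler_prod (p ^ 2) * euler_prod (p ^ 3) ^ 6 / (euler_prod (p ^ 1) ^ 2 * euler_prod (p ^ 6) ^ 3)"
  proof (rule log_deriv_unique[OF _ _ _ _ p])
    fix p :: complex assume p: "0 < norm p" "norm p < 1"
    show "has_log_deriv (\<lambda>p. euler_prod (p ^ 2) * euler_prod (p ^ 3) ^ 6 / (euler_prod (p ^ 1) ^ 2 * euler_prod (p ^ 6) ^ 3))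
      (((- of_nat 2 * sigma_series (p ^ 2)) + of_nat 6 * (- of_nat 3 * sigma_series (p ^ 3))) -
       (of_nat 2 * (- of_nat 1 * sigma_series (p ^ 1)) + of_nat 3 * (- of_nat 6 * sigma_series (p ^ 6)))) p"
      by (intro ld p) (use nz[OF p(2)] nz[OF p(2), of 1] in auto)
    show "has_log_deriv (\<lambda>p. 1 + 2 * eis_a p + 2 * eis_b p)
      (((- of_nat 2 * sigma_series (p ^ 2)) + of_nat 6 * (- of_nat 3 * sigma_series (p ^ 3))) -
       (of_nat 2 * (- of_nat 1 * sigma_series (p ^ 1)) + of_nat 3 * (- of_nat 6 * sigma_series (p ^ 6)))) p"
      by (rule linear_form_log_deriv[OF p(2)])
         (use p in \<open>simp add: distrib_left mult.left_commute[of p] alg; simp add: field_simps eval_nat_numeral\<close>)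
    show "euler_prod (p ^ 2) * euler_prod (p ^ 3) ^ 6 / (euler_prod (p ^ 1) ^ 2 * euler_prod (p ^ 6) ^ 3) \<noteq> 0"
      using nz[OF p(2)] nz[OF p(2), of 1] by simp
  next
    show "((\<lambda>p. (1 + 2 * eis_a p + 2 * eis_b p) / (euler_prod (p ^ 2) * euler_prod (p ^ 3) ^ 6 / (euler_prod (p ^ 1) ^ 2 * euler_prod (p ^ 6) ^ 3))) \<longlongrightarrow> 1) (at 0)"
      by (rule tendsto_eq_intros lim0 euler_prod_power_tendsto refl | simp)+
  qed
  show "1 + (- 6) * eis_a p + 18 * eis_b p =
      euler_prod (p ^ 1) ^ 6 * euler_prod (p ^ 6) / (euler_prod (p ^ 2) ^ 3 * euler_prod (p ^ 3) ^ 2)"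
  proof (rule log_deriv_unique[OF _ _ _ _ p])
    fix p :: complex assume p: "0 < norm p" "norm p < 1"
    show "has_log_deriv (\<lambda>p. euler_prod (p ^ 1) ^ 6 * euler_prod (p ^ 6) / (euler_prod (p ^ 2) ^ 3 * euler_prod (p ^ 3) ^ 2))
      ((of_nat 6 * (- of_nat 1 * sigma_series (p ^ 1)) + (- of_nat 6 * sigma_series (p ^ 6))) -
       (of_nat 3 * (- of_nat 2 * sigma_series (p ^ 2)) + of_nat 2 * (- of_nat 3 * sigma_series (p ^ 3)))) p"
      by (intro ld p) (use nz[OF p(2)] nz[OF p(2), of 1] in auto)
    show "has_log_deriv (\<lambda>p. 1 + (- 6) * eis_a p + 18 * eis_b p)
      ((of_nat 6 * (- of_nat 1 * sigma_series (p ^ 1)) + (- of_nat 6 * sigma_series (p ^ 6))) -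
       (of_nat 3 * (- of_nat 2 * sigma_series (p ^ 2)) + of_nat 2 * (- of_nat 3 * sigma_series (p ^ 3)))) p"
      by (rule linear_form_log_deriv[OF p(2)])
         (use p in \<open>simp add: distrib_left right_diff_distrib mult.left_commute[of p] alg; simp add: field_simps eval_nat_numeral\<close>)
    show "euler_prod (p ^ 1) ^ 6 * euler_prod (p ^ 6) / (euler_prod (p ^ 2) ^ 3 * euler_prod (p ^ 3) ^ 2) \<noteq> 0"
      using nz[OF p(2)] nz[OF p(2), of 1] by simp
  next
    show "((\<lambda>p. (1 + (- 6) * eis_a p + 18 * eis_b p) / (euler_prod (p ^ 1) ^ 6 * euler_prod (p ^ 6) / (euler_prod (p ^ 2) ^ 3 * euler_prod (p ^ 3) ^ 2))) \<longlongrightarrow> 1) (at 0)"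
      by (rule tendsto_eq_intros lim0 euler_prod_power_tendsto refl | simp)+
  qed
  show "0 + 1 * eis_a p + (- 2) * eis_b p =
      p * (euler_prod (p ^ 1) * euler_prod (p ^ 6) ^ 6 / (euler_prod (p ^ 2) ^ 2 * euler_prod (p ^ 3) ^ 3))"
  proof (rule log_deriv_unique[OF _ _ _ _ p])
    fix p :: complex assume p: "0 < norm p" "norm p < 1"
    show "has_log_deriv (\<lambda>p. p * (euler_prod (p ^ 1) * euler_prod (p ^ 6) ^ 6 / (euler_prod (p ^ 2) ^ 2 * euler_prod (p ^ 3) ^ 3)))
      (1 + (((- of_nat 1 * sigma_series (p ^ 1)) + of_nat 6 * (- of_nat 6 * sigma_series (p ^ 6))) -
       (of_nat 2 * (- of_nat 2 * sigma_series (p ^ 2)) + of_nat 3 * (- of_nat 3 * sigma_series (p ^ 3))))) p"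
      by (intro ld p) (use nz[OF p(2)] nz[OF p(2), of 1] in auto)
    show "has_log_deriv (\<lambda>p. 0 + 1 * eis_a p + (- 2) * eis_b p)
      (1 + (((- of_nat 1 * sigma_series (p ^ 1)) + of_nat 6 * (- of_nat 6 * sigma_series (p ^ 6))) -
       (of_nat 2 * (- of_nat 2 * sigma_series (p ^ 2)) + of_nat 3 * (- of_nat 3 * sigma_series (p ^ 3))))) p"
      by (rule linear_form_log_deriv[OF p(2)])
         (use p in \<open>simp add: distrib_left right_diff_distrib mult.left_commute[of p] alg; simp add: field_simps eval_nat_numeral\<close>)
    show "p * (euler_prod (p ^ 1) * euler_prod (p ^ 6) ^ 6 / (euler_prod (p ^ 2) ^ 2 * euler_prod (p ^ 3) ^ 3)) \<noteq> 0"
      using nz[OF p(2)] nz[OF p(2), of 1] p by simp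
  next
    have "((\<lambda>p. eis_a p - 2 * eis_b p) has_field_derivative (1 - 2 * 0)) (at 0)"
      using eis_has_deriv[of 0] by (auto intro!: derivative_eq_intros simp: eis_at_0)
    hence lim1: "((\<lambda>p. (eis_a p - 2 * eis_b p) / p) \<longlongrightarrow> 1) (at 0)"
      by (simp add: has_field_derivative_iff eis_at_0)
    have lim2: "((\<lambda>p. euler_prod (p ^ 1) * euler_prod (p ^ 6) ^ 6 / (euler_prod (p ^ 2) ^ 2 * euler_prod (p ^ 3) ^ 3)) \<longlongrightarrow> 1) (at 0)"
      by (rule tendsto_eq_intros euler_prod_power_tendsto refl | simp)+
    have "((\<lambda>p. (eis_a p - 2 * eis_b p) / p / (euler_prod (p ^ 1) * euler_prod (p ^ 6) ^ 6 / (euler_prod (p ^ 2) ^ 2 * euler_prod (p ^ 3) ^ 3))) \<longlongrightarrow> 1) (at 0)"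
      using tendsto_divide[OF lim1 lim2] by simp
    thus "((\<lambda>p. (0 + 1 * eis_a p + (- 2) * eis_b p) / (p * (euler_prod (p ^ 1) * euler_prod (p ^ 6) ^ 6 / (euler_prod (p ^ 2) ^ 2 * euler_prod (p ^ 3) ^ 3)))) \<longlongrightarrow> 1) (at 0)"
      by (simp add: divide_divide_eq_left mult_ac)
  qed
qed

section \<open>The Schwarzian equation\<close>

definition nome :: "complex \<Rightarrow> complex" where "nome \<tau> = exp (\<i> * of_real pi * \<tau>)"

lemma nome_bounds: "\<tau> \<in> upper_half_plane \<Longrightarrow> 0 < norm (nome \<tau>)" "\<tau> \<in> upper_half_plane \<Longrightarrow> norm (nome \<tau>) < 1"
  by (auto simp: nome_def upper_half_plane_def)

lemma dedekind_eta_nome: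
  "dedekind_eta (of_nat d * \<tau> / 2) = exp (of_nat d * (\<i> * of_real pi * \<tau> / 24)) * euler_prod (nome \<tau> ^ d)"
proof -
  have "exp (2 * of_real pi * \<i> * of_nat (Suc n) * (of_nat d * \<tau> / 2)) = (nome \<tau> ^ d) ^ Suc n" for n
  proof -
    have "(nome \<tau> ^ d) ^ Suc n = exp (of_nat (d * Suc n) * (\<i> * of_real pi * \<tau>))"
      unfolding nome_def power_mult[symmetric] by (rule exp_of_nat_mult[symmetric])
    thus ?thesis by (simp add: algebra_simps)
  qed
  thus ?thesis
    unfolding dedekind_eta_def euler_prod_def by (simp add: algebra_simps)
qed

text \<open>The exponents of the factors exp (i pi d \<tau> / 24) add up to 4 + 48 - 16 - 12 = 24, which gives
  the factor p, and the products are those of the quotient g / f.\<close>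
lemma eta_quotient_t_eq:
  assumes "\<tau> \<in> upper_half_plane"
  shows "eta_quotient_t \<tau> = (eis_a (nome \<tau>) - 2 * eis_b (nome \<tau>)) / (1 + 3 * eis_a (nome \<tau>))"
proof -
  define p where "p = nome \<tau>"
  have p: "0 < norm p" "norm p < 1" using nome_bounds[OF assms] by (auto simp: p_def)
  define P where "P = (\<lambda>d. euler_prod (p ^ d))"
  have nz: "P d \<noteq> 0" if "d > 0" for d
    unfolding P_def using that p by (intro euler_prod_nonzero) (simp add: norm_power power_less_one_iff)
  define x where "x = \<i> * of_real pi * \<tau> / 24"
  have p_x: "p = exp x ^ 24"
    by (simp add: p_def nome_def x_def flip: exp_of_nat_mult)
  have eta: "dedekind_eta (of_nat d * \<tau> / 2) = exp x ^ d * P d" for d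
    unfolding dedekind_eta_nome exp_of_nat_mult by (simp add: P_def p_def x_def)
  have "eta_quotient_t \<tau> = ((exp x ^ 1 * P 1) ^ 4 * (exp x ^ 6 * P 6) ^ 8) / ((exp x ^ 2 * P 2) ^ 8 * (exp x ^ 3 * P 3) ^ 4)"
    unfolding eta_quotient_t_def eta[symmetric] by simp
  also have "\<dots> = exp x ^ 24 * (P 1 ^ 4 * P 6 ^ 8 / (P 2 ^ 8 * P 3 ^ 4))"
    by (simp add: power_mult_distrib divide_simps flip: power_mult power_add)
  also have "\<dots> = p * (P 1 * P 6 ^ 6 / (P 2 ^ 2 * P 3 ^ 3)) / (P 2 ^ 6 * P 3 / (P 1 ^ 3 * P 6 ^ 2))"
    unfolding p_x using nz by (simp add: divide_simps) (simp add: eval_nat_numeral)?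
  also have "\<dots> = (0 + 1 * eis_a p + (- 2) * eis_b p) / (1 + 3 * eis_a p + 0 * eis_b p)"
    unfolding eta_quotients[OF p] P_def ..
  finally show ?thesis by (simp add: p_def)
qed

text \<open>The linear forms of eta_quotients as polynomials, and the logarithmic derivative of D t,
  where D t = t h k.\<close>
definition "form_f a b = (1 + 3 * a :: complex)"
definition "form_g a b = (a - 2 * b :: complex)"
definition "form_h a b = (1 + 2 * a + 2 * b :: complex)"
definition "form_k a b = (1 - 6 * a + 18 * b :: complex)"
definition "dlog_dt a b c = (1 - 12*c + 28*b + 36*b^2 - 8*a + 48*a*b - 24*a^2 :: complex)"

lemma forms_nonzero:
  assumes "0 < norm p" "norm p < 1"
  shows "form_f (eis_a p) (eis_b p) \<noteq> 0" "form_g (eis_a p) (eis_b p) \<noteq> 0" "form_h (eis_a p) (eis_b p) \<noteq> 0" "form_k (eis_a p) (eis_b p) \<noteq> 0"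
proof -
  have nz: "euler_prod (p ^ d) \<noteq> 0" if "d > 0" for d
    using that assms by (intro euler_prod_nonzero) (simp add: norm_power power_less_one_iff)
  have p0: "p \<noteq> 0" using assms by auto
  note e = eta_quotients[OF assms]
  have "1 + 3 * eis_a p + 0 * eis_b p \<noteq> 0" "1 + 2 * eis_a p + 2 * eis_b p \<noteq> 0"
    "1 + (- 6) * eis_a p + 18 * eis_b p \<noteq> 0" "0 + 1 * eis_a p + (- 2) * eis_b p \<noteq> 0"
    unfolding e using nz p0 nz[of 1] by auto
  thus "form_f (eis_a p) (eis_b p) \<noteq> 0" "form_g (eis_a p) (eis_b p) \<noteq> 0" "form_h (eis_a p) (eis_b p) \<noteq> 0" "form_k (eis_a p) (eis_b p) \<noteq> 0"
    by (auto simp: form_f_def form_g_def form_h_def form_k_def)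
qed

text \<open>In terms of D these say D g f - g D f = f g h k (so D t = t h k for t = g / f),
  D (h k) + (h k)^2 = h k U, and the derivative of U in the form D U = U^2 / 2 - Q / 2, where Q is
  the homogenization in (g, f) of the numerator 81 t^4 - ... + 1.\<close>
lemma form_identities:
  fixes a b c :: complex
  shows "(ode_a a b c - 2 * ode_b a b c) * form_f a b - form_g a b * (3 * ode_a a b c) = form_f a b * (form_g a b * form_h a b * form_k a b)"
    and "(2 * ode_a a b c + 2 * ode_b a b c) * form_k a b + form_h a b * (- 6 * ode_a a b c + 18 * ode_b a b c) + form_h a b * form_k a b * (form_h a b * form_k a b)
      = form_h a b * form_k a b * dlog_dt a b c"
    and "- 12 * ode_c a b c + 28 * ode_b a b c + 72 * b * ode_b a b c - 8 * ode_a a b c + 48 * (a * ode_b a b c + ode_a a b c * b) - 48 * a * ode_a a b c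
      = (dlog_dt a b c)\<^sup>2 / 2 - (81 * form_g a b ^ 4 - 108 * form_g a b ^ 3 * form_f a b + 102 * form_g a b ^ 2 * form_f a b ^ 2 - 12 * form_g a b * form_f a b ^ 3 + form_f a b ^ 4) / 2"
  unfolding ode_a_def ode_b_def ode_c_def form_f_def form_g_def form_h_def form_k_def dlog_dt_def
  by (simp_all add: field_simps eval_nat_numeral)


lemma deriv_on_open:
  assumes "open S" "x \<in> S" "\<And>z. z \<in> S \<Longrightarrow> f z = g z" "(g has_field_derivative D) (at x)"
  shows "deriv f x = D"
  using has_field_derivative_transform_within_open[OF assms(4,1,2), of f] assms(3) by (simp add: DERIV_imp_deriv)

theorem theorem10p1:
  fixes \<tau> :: complex
  assumes "\<tau> \<in> upper_half_plane"
  shows "schwarzian eta_quotient_t \<tau> +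
    (81 * eta_quotient_t \<tau> ^ 4 - 108 * eta_quotient_t \<tau> ^ 3 +
       102 * eta_quotient_t \<tau> ^ 2 - 12 * eta_quotient_t \<tau> + 1) /
    (2 * eta_quotient_t \<tau> ^ 2 * (9 * eta_quotient_t \<tau> - 1) ^ 2 *
       (eta_quotient_t \<tau> - 1) ^ 2) *
    (deriv eta_quotient_t \<tau>) ^ 2 = 0"
proof -
  define \<kappa> where "\<kappa> = \<i> * of_real pi"
  have k0: "\<kappa> \<noteq> 0" by (simp add: \<kappa>_def)
  define a where "a = (\<lambda>z. eis_a (nome z))"
  define b where "b = (\<lambda>z. eis_b (nome z))"
  define c where "c = (\<lambda>z. eis_c (nome z))"
  define f where "f = (\<lambda>z. form_f (a z) (b z))"
  define g where "g = (\<lambda>z. form_g (a z) (b z))"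
  define h where "h = (\<lambda>z. form_h (a z) (b z))"
  define k where "k = (\<lambda>z. form_k (a z) (b z))"
  define U where "U = (\<lambda>z. dlog_dt (a z) (b z) (c z))"
  define Q where "Q = (\<lambda>z. 81 * g z ^ 4 - 108 * g z ^ 3 * f z + 102 * g z ^ 2 * f z ^ 2 - 12 * g z * f z ^ 3 + f z ^ 4)"
  have op: "open upper_half_plane"
    unfolding upper_half_plane_def by (rule open_halfspace_Im_gt)
  have nome: "(nome has_field_derivative \<kappa> * nome z) (at z)" for z
    unfolding nome_def \<kappa>_def by (auto intro!: derivative_eq_intros)
  have chain: "((\<lambda>z. F (nome z)) has_field_derivative \<kappa> * D) (at z)"
    if "(F has_field_derivative F') (at (nome z))" "nome z * F' = D" for F F' D z
    using DERIV_chain'[OF nome[of z] that(1)] that(2) by (auto simp: mult_ac)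
  have da: "(a has_field_derivative \<kappa> * ode_a (a z) (b z) (c z)) (at z)"
   and db: "(b has_field_derivative \<kappa> * ode_b (a z) (b z) (c z)) (at z)"
   and dc: "(c has_field_derivative \<kappa> * ode_c (a z) (b z) (c z)) (at z)" if z: "z \<in> upper_half_plane" for z
    unfolding a_def b_def c_def using nome_bounds[OF z]
    by (auto intro!: chain eis_has_deriv eis_ode)
  have nz: "f z \<noteq> 0" "g z \<noteq> 0" "h z \<noteq> 0" "k z \<noteq> 0" if "z \<in> upper_half_plane" for z
    using forms_nonzero nome_bounds[OF that] by (auto simp: f_def g_def h_def k_def a_def b_def)
  define T where "T = (\<lambda>z. g z / f z)"
  define V where "V = (\<lambda>z. T z * (h z * k z))"
  have t_eq: "eta_quotient_t z = T z" if "z \<in> upper_half_plane" for z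
    using eta_quotient_t_eq[OF that] by (simp add: T_def f_def g_def form_f_def form_g_def a_def b_def)
  have dT: "(T has_field_derivative \<kappa> * V z) (at z)" if z: "z \<in> upper_half_plane" for z
  proof -
    have "(f has_field_derivative \<kappa> * (3 * ode_a (a z) (b z) (c z))) (at z)"
      unfolding f_def form_f_def by (auto intro!: derivative_eq_intros da[OF z])
    moreover have "(g has_field_derivative \<kappa> * (ode_a (a z) (b z) (c z) - 2 * ode_b (a z) (b z) (c z))) (at z)"
      unfolding g_def form_g_def by (auto intro!: derivative_eq_intros da[OF z] db[OF z] simp: algebra_simps)
    ultimately have "(T has_field_derivative (\<kappa> * (ode_a (a z) (b z) (c z) - 2 * ode_b (a z) (b z) (c z)) * f z
        - g z * (\<kappa> * (3 * ode_a (a z) (b z) (c z)))) / (f z * f z)) (at z)"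
      unfolding T_def using nz(1)[OF z] by (intro DERIV_divide)
    also have "\<kappa> * (ode_a (a z) (b z) (c z) - 2 * ode_b (a z) (b z) (c z)) * f z - g z * (\<kappa> * (3 * ode_a (a z) (b z) (c z)))
       = \<kappa> * ((ode_a (a z) (b z) (c z) - 2 * ode_b (a z) (b z) (c z)) * f z - g z * (3 * ode_a (a z) (b z) (c z)))"
      by (simp add: algebra_simps)
    also have "\<dots> = \<kappa> * (f z * (g z * h z * k z))"
      unfolding f_def g_def h_def k_def by (simp only: form_identities(1))
    also have "\<dots> / (f z * f z) = \<kappa> * V z"
      using nz(1)[OF z] by (simp add: V_def T_def)
    finally show ?thesis .
  qed
  have dV: "(V has_field_derivative \<kappa> * (V z * U z)) (at z)" if z: "z \<in> upper_half_plane" for z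
  proof -
    have dh: "(h has_field_derivative \<kappa> * (2 * ode_a (a z) (b z) (c z) + 2 * ode_b (a z) (b z) (c z))) (at z)"
      unfolding h_def form_h_def by (auto intro!: derivative_eq_intros da[OF z] db[OF z] simp: algebra_simps)
    have dk: "(k has_field_derivative \<kappa> * (- 6 * ode_a (a z) (b z) (c z) + 18 * ode_b (a z) (b z) (c z))) (at z)"
      unfolding k_def form_k_def by (auto intro!: derivative_eq_intros da[OF z] db[OF z] simp: algebra_simps)
    define h' where "h' = 2 * ode_a (a z) (b z) (c z) + 2 * ode_b (a z) (b z) (c z)"
    define k' where "k' = - 6 * ode_a (a z) (b z) (c z) + 18 * ode_b (a z) (b z) (c z)"
    have "(V has_field_derivative \<kappa> * V z * (h z * k z) + (\<kappa> * h' * k z + \<kappa> * k' * h z) * T z) (at z)"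
      unfolding V_def using DERIV_mult[OF dT[OF z] DERIV_mult[OF dh dk]] by (simp add: V_def h'_def k'_def)
    also have "\<kappa> * V z * (h z * k z) + (\<kappa> * h' * k z + \<kappa> * k' * h z) * T z
       = \<kappa> * T z * (h' * k z + h z * k' + h z * k z * (h z * k z))"
      by (simp add: V_def algebra_simps)
    also have "h' * k z + h z * k' + h z * k z * (h z * k z) = h z * k z * U z"
      unfolding h_def k_def U_def h'_def k'_def by (rule form_identities(2))
    finally show ?thesis by (simp add: V_def mult_ac)
  qed
  have dU: "(U has_field_derivative \<kappa> * (U z ^ 2 / 2 - Q z / 2)) (at z)" if z: "z \<in> upper_half_plane" for z
    unfolding Q_def f_def g_def U_def form_identities(3)[of "a z" "b z" "c z", symmetric]
    unfolding dlog_dt_def by (auto intro!: derivative_eq_intros da[OF z] db[OF z] dc[OF z] simp: algebra_simps)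
  have d1: "deriv eta_quotient_t z = \<kappa> * V z" if z: "z \<in> upper_half_plane" for z
    by (rule deriv_on_open[OF op z t_eq dT[OF z]])
  have d2: "deriv (deriv eta_quotient_t) z = \<kappa> * (\<kappa> * (V z * U z))" if z: "z \<in> upper_half_plane" for z
    by (rule deriv_on_open[OF op z d1 DERIV_cmult[OF dV[OF z]]])
  have d3: "deriv (deriv (deriv eta_quotient_t)) z
      = \<kappa> * (\<kappa> * (\<kappa> * (V z * U z) * U z + \<kappa> * (U z ^ 2 / 2 - Q z / 2) * V z))" if z: "z \<in> upper_half_plane" for z
    by (rule deriv_on_open[OF op z d2 DERIV_cmult[OF DERIV_cmult[OF DERIV_mult[OF dV[OF z] dU[OF z]]]]])
  note z = assms
  have V0: "V \<tau> \<noteq> 0" using nz[OF z] by (simp add: V_def T_def)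
  \<comment> \<open>With D t = V, D V = V U and 2 D U = U^2 - Q the Schwarzian collapses to (i pi)^2 times
    D U - U^2 / 2 = - Q / 2.\<close>
  have S: "schwarzian eta_quotient_t \<tau> = - \<kappa>\<^sup>2 * Q \<tau> / 2"
    unfolding schwarzian_def using V0 k0 d1[OF z] d2[OF z] d3[OF z]
    by (simp add: eval_nat_numeral) (simp add: field_simps power2_eq_square)
  \<comment> \<open>The denominator is 2 t^2 (9 t - 1)^2 (t - 1)^2 = 2 (g h k)^2 / f^6, so the powers of f cancel.\<close>
  have hk: "g \<tau> - f \<tau> = - h \<tau>" "9 * g \<tau> - f \<tau> = - k \<tau>"
    by (simp_all add: f_def g_def h_def k_def form_f_def form_g_def form_h_def form_k_def algebra_simps)
  have "T \<tau> - 1 = - h \<tau> / f \<tau>" "9 * T \<tau> - 1 = - k \<tau> / f \<tau>"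
    unfolding hk[symmetric] using nz[OF z] by (simp_all add: T_def diff_divide_distrib)
  moreover have "81 * T \<tau> ^ 4 - 108 * T \<tau> ^ 3 + 102 * T \<tau> ^ 2 - 12 * T \<tau> + 1 = Q \<tau> / f \<tau> ^ 4"
    using nz[OF z] by (simp add: T_def Q_def field_simps eval_nat_numeral)
  ultimately show ?thesis
    unfolding S t_eq[OF z] d1[OF z] V_def using nz[OF z]
    by (simp add: T_def) (simp add: field_simps eval_nat_numeral)
qed

end
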